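(* Let $k \ge 2$ and $0 \le l < \frac{k}{2}$ be integers, and let $v \in \mathbb{R}^3$ be a nonzero vector. The projection of $\mathcal{F}^3(k, D_{k,l})$ along $v$ has positive (two-dimensional) Lebesgue measure if and only if $v$ is a nonzero real multiple of a coprime vector $(a,b,c)$ such that: (a) when $(k,l) \ne (3,1)$: $a+b+c$ is coprime to $k$; (b) when $(k,l) = (3,1)$: either $a+b+c$ is coprime to $3$, or [$3 \mid a+b+c$ and $a \equiv b \equiv -\frac{a+b+c}{3} \not\equiv 0 \pmod 3$].
   Context: For an integer $k\ge 2$ and a finite set $D\subset\mathbb{R}^n$, $\mathcal{F}^n(k,D)$ denotes the unique nonempty compact set $T\subset\mathbb{R}^n$ with $T=\bigcup_{d\in D}\frac{T+d}{k}$ (the attractor of the iterated function system $f_d(x)=\frac{x+d}{k}$, $d\in D$). For integers $k\ge2$ and $0\le l<\frac k2$, $$D_{k,l}=\{(x,y,z)\in\mathbb{Z}^3 \mid 0\le x,y,z\le k-1,\ x+y+z\equiv l-1 \pmod k\}.$$ A coprime vector is a vector $(a,b,c)\in\mathbb{Z}^3$ with $\gcd(a,b,c)=1$. The projection along a nonzero vector $v\in\mathbb{R}^3$ is a surjective linear map $\varphi:\mathbb{R}^3\to\mathbb{R}^2$ with kernel $\mathbb{R}v$; whether the image of a set has positive Lebesgue measure does not depend on the choice of such $\varphi$. *)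

theory Defs
  imports "HOL-Analysis.Analysis" "HOL-Number_Theory.Cong"
begin

(* For 2 <= k and D finite and nonempty the maps x |-> (x + d) / k are contractions, so by
   Hutchinson's theorem exactly one such T exists; otherwise the value is unspecified. *)
definition attractor :: "int \<Rightarrow> (real ^ 'n) set \<Rightarrow> (real ^ 'n) set" where
  "attractor k D =
     (THE T. T \<noteq> {} \<and> compact T \<and> T = (\<Union>d\<in>D. (\<lambda>x. (x + d) /\<^sub>R real_of_int k) ` T))"

definition int_vec3 :: "int \<Rightarrow> int \<Rightarrow> int \<Rightarrow> real ^ 3" where
  "int_vec3 a b c = vector [real_of_int a, real_of_int b, real_of_int c]"

definition digit_set :: "int \<Rightarrow> int \<Rightarrow> (real ^ 3) set" where
  "digit_set k l =
     {int_vec3 x y z | x y z.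
        x \<in> {0..k - 1} \<and> y \<in> {0..k - 1} \<and> z \<in> {0..k - 1} \<and> [x + y + z = l - 1] (mod k)}"

definition projection_along :: "real ^ 3 \<Rightarrow> (real ^ 3 \<Rightarrow> real ^ 2) \<Rightarrow> bool" where
  "projection_along v \<phi> \<longleftrightarrow> linear \<phi> \<and> surj \<phi> \<and> {x. \<phi> x = 0} = range (\<lambda>t. t *\<^sub>R v)"

definition coprime_vector :: "int \<Rightarrow> int \<Rightarrow> int \<Rightarrow> bool" where
  "coprime_vector a b c \<longleftrightarrow> gcd a (gcd b c) = 1"

end

theory Submission
  imports Defs
begin

text \<open>
  Let \<open>D\<^sub>n\<close> be the set of sums \<open>\<Sum>j<n. k\<^sup>j d\<^sub>j\<close> with digits \<open>d\<^sub>j \<in> D\<close>; it has \<open>k\<^sup>2\<^sup>n\<close> elements.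
  The projection \<open>S\<close> of the attractor satisfies \<open>k\<^sup>n S = S + \<phi> D\<^sub>n\<close>, so comparing areas shows that
  \<open>S\<close> has positive measure iff the points of \<open>\<phi> D\<^sub>n\<close> are pairwise distinct and uniformly separated in \<open>n\<close>,
  i.e. iff no nonzero element of \<open>E = \<Union>n. D\<^sub>n - D\<^sub>n\<close> lies too close to the line \<open>\<real>v\<close>.

  An integer vector \<open>w\<close> lies in \<open>E\<close> iff one can reach \<open>0\<close> from it by steps \<open>w \<mapsto> (w - \<delta>) / k\<close> with
  \<open>\<delta> \<in> D - D\<close>. If \<open>w \<noteq> 0\<close> modulo \<open>k\<close> and \<open>k\<close> divides the coordinate sum of \<open>w\<close>, then \<open>\<delta>\<close> can be chosen with
  coordinate sum \<open>0\<close>, and with coordinate sum \<open>\<plusminus>k\<close> as well unless \<open>(k, l) = (3, 1)\<close> and \<open>w = \<plusminus>(2, 2, 2)\<close>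
  modulo \<open>3\<close>. Hence vectors with coordinate sum \<open>0\<close> lie in \<open>E\<close>, and so do most vectors with coordinate sum
  \<open>k\<^sup>A (k\<^sup>n - 1)\<close>, \<open>A \<ge> 1\<close>. If \<open>v\<close> is normalised to have coordinate sum \<open>1\<close>, the pigeonhole principle
  for the points \<open>k\<^sup>i v\<close> modulo \<open>\<int>\<^sup>3\<close> yields such vectors arbitrarily close to \<open>\<real>v\<close> when \<open>v\<close> is
  irrational; for rational \<open>v\<close> with forbidden \<open>a + b + c\<close> it yields a multiple of \<open>(a, b, c)\<close> in \<open>E\<close>.
  Conversely the conditions (a) and (b) exclude nonzero multiples of \<open>(a, b, c)\<close> in \<open>E\<close> by a congruence
  modulo \<open>k\<close>, respectively modulo \<open>9\<close>.
\<close>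

section \<open>Attractors\<close>

definition hutchinson :: "int \<Rightarrow> (real ^ 'n) set \<Rightarrow> (real ^ 'n) set \<Rightarrow> (real ^ 'n) set" where
  "hutchinson k D T = (\<Union>d\<in>D. (\<lambda>x. (x + d) /\<^sub>R real_of_int k) ` T)"

lemma hutchinson_iff:
  assumes "2 \<le> k"
  shows "x \<in> hutchinson k D T \<longleftrightarrow> (\<exists>d\<in>D. real_of_int k *\<^sub>R x - d \<in> T)"
proof
  assume "x \<in> hutchinson k D T"
  then obtain d y where "d \<in> D" "y \<in> T" "x = (y + d) /\<^sub>R real_of_int k" unfolding hutchinson_def by blast
  moreover from this have "real_of_int k *\<^sub>R x - d = y" using assms by simp
  ultimately show "\<exists>d\<in>D. real_of_int k *\<^sub>R x - d \<in> T" by metis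
next
  assume "\<exists>d\<in>D. real_of_int k *\<^sub>R x - d \<in> T"
  then obtain d where d: "d \<in> D" "real_of_int k *\<^sub>R x - d \<in> T" by blast
  have "x = (real_of_int k *\<^sub>R x - d + d) /\<^sub>R real_of_int k" using assms by simp
  with d show "x \<in> hutchinson k D T" unfolding hutchinson_def by blast
qed

text \<open>Iterating the operator on an invariant ball gives a decreasing sequence of nonempty
  compact sets, whose intersection is the fixpoint.\<close>

lemma hutchinson_fixpoint_exists:
  assumes k: "2 \<le> k" and D: "finite D" "D \<noteq> {}"
  shows "\<exists>T. T \<noteq> {} \<and> compact T \<and> T = hutchinson k D T"
proof -
  \<comment> \<open>As \<open>k >= 2\<close>, a point \<open>(x + d) / k\<close> with
    \<open>|x|, |d| <= R\<close> has norm at most \<open>2 R / k <= R\<close>, so the ball of radius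
    \<open>R\<close> is invariant.\<close>
  define R where "R = Max (norm ` D)"
  have R: "norm d \<le> R" if "d \<in> D" for d using D that unfolding R_def by simp
  define K where "K n = (hutchinson k D ^^ n) (cball 0 R)" for n
  have Ks: "K (Suc n) = hutchinson k D (K n)" for n unfolding K_def by simp
  have K0: "hutchinson k D (cball 0 R) \<subseteq> cball 0 R"
  proof
    fix x assume "x \<in> hutchinson k D (cball 0 R)"
    then obtain d where d: "d \<in> D" "norm (real_of_int k *\<^sub>R x - d) \<le> R"
      using hutchinson_iff[OF k] by (metis mem_cball_0)
    have "real_of_int k * norm x = norm (real_of_int k *\<^sub>R x)" using k by simp
    also have "\<dots> \<le> norm (real_of_int k *\<^sub>R x - d) + norm d" by (metis diff_add_cancel norm_triangle_ineq)
    also have "\<dots> \<le> 2 * R" using d R by fastforce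
    finally have "real_of_int k * norm x \<le> 2 * R" .
    moreover have "2 * norm x \<le> real_of_int k * norm x" using k by (intro mult_right_mono) auto
    ultimately show "x \<in> cball 0 R" by simp
  qed
  have mono: "hutchinson k D A \<subseteq> hutchinson k D B" if "A \<subseteq> B" for A B
    using that unfolding hutchinson_def by blast
  have dec1: "K (Suc n) \<subseteq> K n" for n
  proof (induction n)
    case 0 show ?case using K0 unfolding K_def by simp
  next
    case (Suc n) thus ?case using mono Ks by metis
  qed
  have dec: "K n \<subseteq> K m" if "m \<le> n" for m n using lift_Suc_antimono_le[of K, OF dec1 that] .
  have cpt: "compact (K n) \<and> K n \<noteq> {}" for n
  proof (induction n)
    case 0
    have "0 \<le> R" using R D(2) by (meson all_not_in_conv norm_ge_zero order_trans)
    thus ?case unfolding K_def by simp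
  next
    case (Suc n)
    have "compact (\<Union>d\<in>D. (\<lambda>x. (x + d) /\<^sub>R real_of_int k) ` K n)"
      using Suc D(1) by (intro compact_UN compact_continuous_image continuous_intros) auto
    thus ?case using Suc D(2) unfolding Ks hutchinson_def by auto
  qed
  define T where "T = (\<Inter>n. K n)"
  have "T \<noteq> {}" unfolding T_def using cpt dec by (intro compact_nest) auto
  moreover have "compact T" unfolding T_def using cpt by (intro compact_Inter) auto
  moreover have "T = hutchinson k D T"
  proof (intro equalityI subsetI)
    fix x assume x: "x \<in> hutchinson k D T"
    have "x \<in> K n" for n
      using x mono[of T "K n"] dec1[of n] Ks[of n] unfolding T_def by blast
    thus "x \<in> T" unfolding T_def by blast
  next
    fix x assume x: "x \<in> T"
    show "x \<in> hutchinson k D T"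
    proof (rule ccontr)
      assume "x \<notin> hutchinson k D T"
      hence "\<forall>d\<in>D. \<exists>n. real_of_int k *\<^sub>R x - d \<notin> K n"
        unfolding hutchinson_iff[OF k] T_def by blast
      then obtain f where f: "\<forall>d\<in>D. real_of_int k *\<^sub>R x - d \<notin> K (f d)" by metis
      define N where "N = Max (f ` D)"
      have "x \<in> K (Suc N)" using x unfolding T_def by blast
      then obtain d where d: "d \<in> D" "real_of_int k *\<^sub>R x - d \<in> K N"
        unfolding Ks hutchinson_iff[OF k] by blast
      have "f d \<le> N" using d(1) D(1) unfolding N_def by simp
      thus False using f d dec by blast
    qed
  qed
  ultimately show ?thesis by blast
qed

text \<open>A point of \<open>T\<close> is tracked by a point of \<open>S\<close> with the same
  first \<open>n\<close> digits, at distance \<open>O(k^-n)\<close>; hence \<open>T\<close> lies in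
  the closure of \<open>S\<close>. Used in both directions this gives uniqueness.\<close>

lemma hutchinson_fixpoint_subset:
  assumes k: "2 \<le> k" and T: "compact T" "T = hutchinson k D T"
    and S: "S \<noteq> {}" "compact S" "S = hutchinson k D S"
  shows "T \<subseteq> S"
proof
  fix x assume "x \<in> T"
  obtain B where B: "\<And>x. x \<in> T \<Longrightarrow> norm x \<le> B" using compact_imp_bounded[OF T(1)] bounded_iff by metis
  obtain y0 where y0: "y0 \<in> S" using S(1) by blast
  have approx: "\<exists>y\<in>S. real_of_int k ^ n * norm (x - y) \<le> B + norm y0" if "x \<in> T" for n x
    using that
  proof (induction n arbitrary: x)
    case 0
    have "norm (x - y0) \<le> B + norm y0" using B[OF 0] norm_triangle_ineq4[of x y0] by linarith
    thus ?case using y0 by auto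
  next
    case (Suc n)
    then obtain d where d: "d \<in> D" "real_of_int k *\<^sub>R x - d \<in> T" using T(2) hutchinson_iff[OF k] by blast
    from Suc.IH[OF d(2)] obtain y where
      y: "y \<in> S" "real_of_int k ^ n * norm (real_of_int k *\<^sub>R x - d - y) \<le> B + norm y0" by blast
    define z where "z = (y + d) /\<^sub>R real_of_int k"
    have "z \<in> hutchinson k D S" using y(1) d(1) unfolding hutchinson_def z_def by blast
    hence "z \<in> S" using S(3) by simp
    have "real_of_int k *\<^sub>R x - d - y = real_of_int k *\<^sub>R (x - z)"
      using k unfolding z_def by (simp add: algebra_simps)
    hence "real_of_int k ^ n * (real_of_int k * norm (x - z)) \<le> B + norm y0"
      using y(2) k by simp
    thus ?case using \<open>z \<in> S\<close> by (auto simp: mult.assoc mult.left_commute)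
  qed
  have "x \<in> closure S" unfolding closure_approachable
  proof (intro allI impI)
    fix e :: real assume e: "0 < e"
    have "1 < real_of_int k" using k by simp
    then obtain n where n: "(B + norm y0) / e < real_of_int k ^ n" using real_arch_pow by blast
    obtain y where y: "y \<in> S" "real_of_int k ^ n * norm (x - y) \<le> B + norm y0"
      using approx[OF \<open>x \<in> T\<close>] by blast
    have "B + norm y0 < real_of_int k ^ n * e" using n e by (simp add: field_simps)
    hence "real_of_int k ^ n * norm (x - y) < real_of_int k ^ n * e" using y(2) by linarith
    hence "norm (x - y) < e" using k by simp
    thus "\<exists>y\<in>S. dist y x < e" using y(1) by (metis dist_norm norm_minus_commute)
  qed
  thus "x \<in> S" using S(2) by (simp add: compact_imp_closed)
qed

lemma attractor_fixpoint:
  assumes "2 \<le> k" "finite D" "D \<noteq> {}"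
  shows "attractor k D \<noteq> {}" "compact (attractor k D)" "attractor k D = hutchinson k D (attractor k D)"
proof -
  have "\<exists>!T. T \<noteq> {} \<and> compact T \<and> T = hutchinson k D T"
    using hutchinson_fixpoint_exists[OF assms] hutchinson_fixpoint_subset[OF assms(1)]
    by (metis subset_antisym)
  from theI'[OF this] show "attractor k D \<noteq> {}" "compact (attractor k D)"
    "attractor k D = hutchinson k D (attractor k D)"
    unfolding attractor_def hutchinson_def by blast+
qed

section \<open>Measure and separated translates\<close>

lemma open_superset_measure_less:
  fixes S :: "'a::euclidean_space set"
  assumes "compact S" "0 < e"
  obtains U where "open U" "S \<subseteq> U" "U \<in> lmeasurable" "measure lebesgue U < measure lebesgue S + e"
proof -
  have S: "S \<in> lmeasurable" using lmeasurable_compact[OF assms(1)] .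
  obtain U where U: "open U" "S \<subseteq> U" "U - S \<in> lmeasurable" "emeasure lebesgue (U - S) < ennreal e"
    using sets_lebesgue_outer_open[OF fmeasurableD[OF S] assms(2)] by metis
  have "U = S \<union> (U - S)" using U(2) by blast
  hence m: "U \<in> lmeasurable" using S U(3) by (metis fmeasurable.Un)
  have "measure lebesgue (U - S) < e"
    using U(3,4) assms(2) by (metis emeasure_eq_measure2 ennreal_less_iff measure_nonneg)
  moreover have "measure lebesgue (U - S) = measure lebesgue U - measure lebesgue S"
    using S m U(2) by (metis measurable_measure_Diff fmeasurableD)
  ultimately show thesis using that U m by simp
qed

text \<open>If two of the \<open>c\<^sup>d\<close> translates covering \<open>c S\<close> were too close, they would together have less than
  twice the measure of \<open>S\<close>, which is not enough to cover.\<close>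
lemma cover_translates_separated:
  fixes S :: "'a::euclidean_space set"
  assumes S: "compact S" "0 < measure lebesgue S"
  obtains \<epsilon> where "0 < \<epsilon>"
    "\<And>I (p :: 'i \<Rightarrow> 'a) c i j. finite I \<Longrightarrow> 0 < c \<Longrightarrow> real (card I) = c ^ DIM('a) \<Longrightarrow>
      (\<lambda>x. c *\<^sub>R x) ` S \<subseteq> (\<Union>i\<in>I. (\<lambda>x. p i + x) ` S) \<Longrightarrow> i \<in> I \<Longrightarrow> j \<in> I \<Longrightarrow> i \<noteq> j \<Longrightarrow>
      \<epsilon> \<le> norm (p i - p j)"
proof -
  define \<mu> where "\<mu> = measure lebesgue S"
  obtain U where U: "open U" "S \<subseteq> U" "U \<in> lmeasurable" "measure lebesgue U < \<mu> + \<mu>"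
    using open_superset_measure_less[OF S] unfolding \<mu>_def by blast
  obtain \<epsilon> where \<epsilon>: "\<epsilon> > 0" "(\<Union>x\<in>S. ball x \<epsilon>) \<subseteq> U"
    using compact_subset_open_imp_ball_epsilon_subset[OF S(1) U(1,2)] by blast
  have Sm: "S \<in> lmeasurable" using lmeasurable_compact[OF S(1)] .
  have "\<epsilon> \<le> norm (p i - p j)"
    if I: "finite I" and c: "0 < c" "real (card I) = c ^ DIM('a)"
      and cov: "(\<lambda>x. c *\<^sub>R x) ` S \<subseteq> (\<Union>i\<in>I. (\<lambda>x. p i + x) ` S)" and ij: "i \<in> I" "j \<in> I" "i \<noteq> j"
    for I and p :: "'i \<Rightarrow> 'a" and c i j
  proof (rule ccontr)
    assume "\<not> \<epsilon> \<le> norm (p i - p j)"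
    hence close: "norm (p i - p j) < \<epsilon>" by simp
    define J where "J = I - {i, j}"
    \<comment> \<open>One translate of \<open>U\<close> absorbs both close copies of
      \<open>S\<close> at a cost below twice the measure of \<open>S\<close>; the other
      \<open>card I - 2\<close> copies are collected in \<open>W\<close>.\<close>
    define V where "V = (\<lambda>x. p i + x) ` U"
    define W where "W = (\<Union>h\<in>J. (\<lambda>x. p h + x) ` S)"
    have Vi: "(\<lambda>x. p i + x) ` S \<subseteq> V" unfolding V_def using U(2) by blast
    have Vj: "(\<lambda>x. p j + x) ` S \<subseteq> V"
    proof safe
      fix x assume "x \<in> S"
      moreover have "x + (p j - p i) \<in> ball x \<epsilon>" using close by (simp add: dist_norm norm_minus_commute)
      ultimately have "x + (p j - p i) \<in> U" using \<epsilon>(2) by blast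
      moreover have "p j + x = p i + (x + (p j - p i))" by simp
      ultimately show "p j + x \<in> V" unfolding V_def by blast
    qed
    have Wh: "(\<lambda>x. p h + x) ` S \<subseteq> W" if "h \<in> J" for h
      unfolding W_def using that by (intro UN_upper)
    have "(\<lambda>x. p h + x) ` S \<subseteq> V \<union> W" if "h \<in> I" for h
    proof -
      have "h = i \<or> h = j \<or> h \<in> J" using that unfolding J_def by blast
      thus ?thesis using Vi Vj Wh[of h] by (meson le_supI1 le_supI2)
    qed
    hence "(\<Union>h\<in>I. (\<lambda>x. p h + x) ` S) \<subseteq> V \<union> W" by (intro UN_least)
    with cov have sub: "(\<lambda>x. c *\<^sub>R x) ` S \<subseteq> V \<union> W" by (rule order_trans)
    have V: "V \<in> lmeasurable" "measure lebesgue V = measure lebesgue U"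
      unfolding V_def using U(3) by (simp_all add: measurable_translation measure_translation)
    have fJ: "finite J" unfolding J_def using I by simp
    have W: "W \<in> lmeasurable" unfolding W_def
      using fJ Sm by (intro fmeasurable.finite_UN) (simp_all add: measurable_translation)
    have "measure lebesgue W \<le> (\<Sum>h\<in>J. measure lebesgue ((\<lambda>x. p h + x) ` S))"
      unfolding W_def using fJ Sm by (intro measure_UNION_le) (simp_all add: measurable_translation fmeasurableD)
    also have "\<dots> = real (card J) * \<mu>" unfolding \<mu>_def by (simp add: measure_translation)
    finally have mW: "measure lebesgue W \<le> real (card J) * \<mu>" .
    have cJ: "real (card J) = real (card I) - 2"
    proof -
      have "card {i, j} \<le> card I" using I ij by (intro card_mono) auto
      moreover have "card J = card I - card {i, j}" unfolding J_def using ij by (intro card_Diff_subset) auto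
      ultimately show ?thesis using ij(3) by (simp add: of_nat_diff)
    qed
    have "c ^ DIM('a) * \<mu> = measure lebesgue ((\<lambda>x. c *\<^sub>R x) ` S)"
      using measure_lebesgue_affine[of c 0 S] c(1) unfolding \<mu>_def by simp
    also have "\<dots> \<le> measure lebesgue (V \<union> W)"
    proof (rule measure_mono_fmeasurable[OF sub])
      have "compact ((\<lambda>x. c *\<^sub>R x) ` S)" by (rule compact_scaling[OF S(1)])
      thus "(\<lambda>x. c *\<^sub>R x) ` S \<in> sets lebesgue" using lmeasurable_compact fmeasurableD by blast
      show "V \<union> W \<in> lmeasurable" using V W by (intro fmeasurable.Un)
    qed
    also have "\<dots> \<le> measure lebesgue V + measure lebesgue W"
      using V(1) W by (intro measure_Un_le) (simp_all add: fmeasurableD)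
    also have "\<dots> < real (card I) * \<mu>" using V(2) U(4) mW cJ by (simp add: left_diff_distrib)
    finally show False using c(2) by simp
  qed
  with \<epsilon>(1) that show thesis by blast
qed

text \<open>If \<open>S\<close> were null, a neighbourhood \<open>U\<close> of it would have less
  measure than one ball of radius \<open>\<delta> / 2\<close>. For large \<open>c\<close> the set
  \<open>c U\<close> contains \<open>c^d\<close> disjoint such balls, around the points
  \<open>p i\<close>, contradicting \<open>|c U| = c^d |U|\<close>.\<close>

lemma positive_measure_of_separated_points:
  fixes S :: "'a::euclidean_space set"
  assumes S: "compact S" and \<delta>: "0 < \<delta>"
    and pts: "\<And>C. \<exists>I (p :: 'i \<Rightarrow> 'a) c. C < c \<and> 0 < c \<and> finite I \<and> real (card I) = c ^ DIM('a) \<and>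
      (\<forall>i\<in>I. \<forall>j\<in>I. i \<noteq> j \<longrightarrow> \<delta> \<le> norm (p i - p j)) \<and> (\<forall>i\<in>I. \<exists>x\<in>S. norm (c *\<^sub>R x - p i) \<le> R)"
  shows "0 < measure lebesgue S"
proof (rule ccontr)
  assume "\<not> ?thesis"
  hence null: "measure lebesgue S = 0" using measure_nonneg[of lebesgue S] by linarith
  define e where "e = measure lebesgue (ball (0::'a) (\<delta> / 2))"
  have "0 < e" unfolding e_def using \<delta> by simp
  then obtain U where U: "open U" "S \<subseteq> U" "U \<in> lmeasurable" "measure lebesgue U < e"
    using open_superset_measure_less[OF S] null by (metis add_0)
  obtain \<epsilon> where \<epsilon>: "\<epsilon> > 0" "(\<Union>x\<in>S. ball x \<epsilon>) \<subseteq> U"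
    using compact_subset_open_imp_ball_epsilon_subset[OF S U(1,2)] by blast
  obtain I and p :: "'i \<Rightarrow> 'a" and c where *: "(R + \<delta> / 2) / \<epsilon> < c \<and> 0 < c \<and> finite I \<and>
      real (card I) = c ^ DIM('a) \<and> (\<forall>i\<in>I. \<forall>j\<in>I. i \<noteq> j \<longrightarrow> \<delta> \<le> norm (p i - p j)) \<and>
      (\<forall>i\<in>I. \<exists>x\<in>S. norm (c *\<^sub>R x - p i) \<le> R)"
    using pts[of "(R + \<delta> / 2) / \<epsilon>"] by (elim exE)
  have c: "(R + \<delta> / 2) / \<epsilon> < c" "0 < c" and I: "finite I" "real (card I) = c ^ DIM('a)"
    using * by simp_all
  have sep: "\<delta> \<le> norm (p i - p j)" if "i \<in> I" "j \<in> I" "i \<noteq> j" for i j using * that by simp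
  have near: "\<exists>x\<in>S. norm (c *\<^sub>R x - p i) \<le> R" if "i \<in> I" for i using * that by simp
  have sub: "(\<Union>i\<in>I. ball (p i) (\<delta> / 2)) \<subseteq> (\<lambda>x. c *\<^sub>R x) ` U"
  proof
    fix y assume "y \<in> (\<Union>i\<in>I. ball (p i) (\<delta> / 2))"
    then obtain i where i: "i \<in> I" "norm (p i - y) < \<delta> / 2" by (auto simp: dist_norm)
    obtain x where x: "x \<in> S" "norm (c *\<^sub>R x - p i) \<le> R" using near[OF i(1)] by blast
    have "norm (c *\<^sub>R x - y) \<le> norm (c *\<^sub>R x - p i) + norm (p i - y)"
      using norm_triangle_ineq[of "c *\<^sub>R x - p i" "p i - y"] by simp
    also have "\<dots> < c * \<epsilon>" using x(2) i(2) c(1) \<epsilon>(1) by (simp add: field_simps)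
    finally have "norm (c *\<^sub>R x - y) < c * \<epsilon>" .
    moreover have "c *\<^sub>R x - y = c *\<^sub>R (x - y /\<^sub>R c)" using c(2) by (simp add: algebra_simps)
    ultimately have "c * norm (x - y /\<^sub>R c) < c * \<epsilon>" using c(2) by simp
    hence "y /\<^sub>R c \<in> ball x \<epsilon>" using c(2) by (simp add: dist_norm)
    hence "y /\<^sub>R c \<in> U" using \<epsilon>(2) x(1) by blast
    moreover have "y = c *\<^sub>R (y /\<^sub>R c)" using c(2) by simp
    ultimately show "y \<in> (\<lambda>x. c *\<^sub>R x) ` U" by blast
  qed
  have ball: "measure lebesgue (ball (p i) (\<delta> / 2)) = e" for i
    unfolding e_def using measure_translation[of "p i" "ball 0 (\<delta> / 2)"] by (simp add: ball_translation[symmetric])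
  have "c ^ DIM('a) * e = (\<Sum>i\<in>I. measure lebesgue (ball (p i) (\<delta> / 2)))" using I(2) by (simp add: ball)
  also have "\<dots> = measure lebesgue (\<Union>i\<in>I. ball (p i) (\<delta> / 2))"
  proof (rule measure_finite_Union[symmetric])
    show "disjoint_family_on (\<lambda>i. ball (p i) (\<delta> / 2)) I"
      unfolding disjoint_family_on_def
    proof (intro ballI impI)
      fix i j assume ij: "i \<in> I" "j \<in> I" "i \<noteq> j"
      show "ball (p i) (\<delta> / 2) \<inter> ball (p j) (\<delta> / 2) = {}"
        using sep[OF ij] by (intro disjoint_ballI) (simp add: dist_norm)
    qed
    show "emeasure lebesgue (ball (p i) (\<delta> / 2)) \<noteq> \<infinity>" if "i \<in> I" for i
      using emeasure_bounded_finite[of "ball (p i) (\<delta> / 2)"] by (simp add: less_top[symmetric])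
  qed (use I in auto)
  also have "\<dots> \<le> measure lebesgue ((\<lambda>x. c *\<^sub>R x) ` U)"
  proof (rule measure_mono_fmeasurable[OF sub])
    show "(\<Union>i\<in>I. ball (p i) (\<delta> / 2)) \<in> sets lebesgue" 
      by (metis (no_types, lifting) open_UN open_ball borel_open sets_completionI_sets sets_lborel)
    have "open ((\<lambda>x. c *\<^sub>R x) ` U)" using open_scaling[OF _ U(1), of c] c(2) by simp
    hence "(\<lambda>x. c *\<^sub>R x) ` U \<in> sets lebesgue" by (metis borel_open sets_completionI_sets sets_lborel)
    moreover have "emeasure lebesgue ((\<lambda>x. c *\<^sub>R x) ` U) < \<infinity>"
      using emeasure_lebesgue_affine[of c 0 U] U(3) c(2)
      by (simp add: fmeasurable_def ennreal_mult_less_top ennreal_power del: emeasure_completion)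
    ultimately show "(\<lambda>x. c *\<^sub>R x) ` U \<in> lmeasurable" by (rule fmeasurableI)
  qed
  also have "\<dots> = c ^ DIM('a) * measure lebesgue U" using measure_lebesgue_affine[of c 0 U] c(2) by simp
  also have "\<dots> < c ^ DIM('a) * e" using U(4) c(2) by simp
  finally show False by simp
qed

section \<open>Linear projections and integer vectors\<close>

lemma int_vec3_components [simp]:
  "int_vec3 a b c $ 1 = of_int a" "int_vec3 a b c $ 2 = of_int b" "int_vec3 a b c $ 3 = of_int c"
  unfolding int_vec3_def by simp_all

lemma vec3_eq_iff: "(x :: real ^ 3) = y \<longleftrightarrow> x $ 1 = y $ 1 \<and> x $ 2 = y $ 2 \<and> x $ 3 = y $ 3"
  by (simp add: vec_eq_iff forall_3)

lemma int_vec3_diff: "int_vec3 a b c - int_vec3 a' b' c' = int_vec3 (a - a') (b - b') (c - c')"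
  by (simp add: vec3_eq_iff)

lemma projection_alongD:
  assumes "projection_along v \<phi>"
  shows "linear \<phi>" "surj \<phi>" "\<phi> x = 0 \<longleftrightarrow> (\<exists>t. x = t *\<^sub>R v)" "\<phi> (t *\<^sub>R v) = 0"
  using assms unfolding projection_along_def by (auto simp: set_eq_iff image_iff)

lemma projection_norm_le:
  fixes \<phi> :: "real ^ 3 \<Rightarrow> real ^ 2"
  assumes "linear \<phi>"
  obtains K where "0 < K" "\<And>x. norm (\<phi> x) \<le> K * (\<bar>x $ 1\<bar> + \<bar>x $ 2\<bar> + \<bar>x $ 3\<bar>)"
proof -
  obtain K where K: "0 < K" "\<And>x. norm (\<phi> x) \<le> K * norm x"
    using linear_bounded_pos[OF assms] by blast
  have "norm (\<phi> x) \<le> K * (\<bar>x $ 1\<bar> + \<bar>x $ 2\<bar> + \<bar>x $ 3\<bar>)" for x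
  proof -
    have "norm x \<le> \<bar>x $ 1\<bar> + \<bar>x $ 2\<bar> + \<bar>x $ 3\<bar>" using norm_le_l1_cart[of x] by (simp add: sum_3)
    hence "K * norm x \<le> K * (\<bar>x $ 1\<bar> + \<bar>x $ 2\<bar> + \<bar>x $ 3\<bar>)" using K(1) by (intro mult_left_mono) auto
    thus ?thesis using K(2) order_trans by blast
  qed
  with K(1) that show thesis by blast
qed

text \<open>\<open>f\<close> vanishes on the kernel of \<open>\<phi>\<close>, so it factors through
  \<open>\<phi>\<close> as a linear, hence bounded, functional on the plane.\<close>

lemma projection_bounds_functional:
  fixes f :: "real ^ 3 \<Rightarrow> real"
  assumes "projection_along v \<phi>" "linear f" "f v = 0"
  obtains C where "0 < C" "\<And>x. \<bar>f x\<bar> \<le> C * norm (\<phi> x)"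
proof -
  note p = projection_alongD[OF assms(1)]
  obtain g where g: "linear g" "\<phi> \<circ> g = id" using linear_surjective_right_inverse[OF p(1,2)] by blast
  have "linear (f \<circ> g)" using linear_compose[OF g(1) assms(2)] .
  then obtain C where C: "0 < C" "\<And>y. norm ((f \<circ> g) y) \<le> C * norm y" using linear_bounded_pos by blast
  have "f x = (f \<circ> g) (\<phi> x)" for x
  proof -
    have "\<phi> (x - g (\<phi> x)) = 0" using g(2) by (simp add: linear_diff[OF p(1)] o_def fun_eq_iff)
    then obtain t where "x - g (\<phi> x) = t *\<^sub>R v" using p(3) by blast
    hence "f (x - g (\<phi> x)) = 0" using assms(3) linear_cmul[OF assms(2)] by simp
    thus ?thesis using linear_diff[OF assms(2)] by simp
  qed
  thus thesis using that C by (metis real_norm_def)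
qed

lemma integer_vector_primitive:
  assumes "(a, b, c) \<noteq> (0, 0, 0)"
  obtains g a' b' c' where "a = g * a'" "b = g * b'" "c = g * c'" "g \<noteq> 0" "coprime_vector a' b' c'"
proof -
  define g where "g = gcd a (gcd b c)"
  have g0: "g \<noteq> 0" using assms unfolding g_def by auto
  have "g dvd a" "g dvd b" "g dvd c" unfolding g_def by (auto intro: dvd_trans[OF gcd_dvd2])
  then obtain a' b' c' where e: "a = g * a'" "b = g * b'" "c = g * c'" by (elim dvdE)
  have "gcd a' (gcd b' c') dvd 1"
  proof -
    define h where "h = gcd a' (gcd b' c')"
    have "h dvd a'" "h dvd b'" "h dvd c'" unfolding h_def by (auto intro: dvd_trans[OF gcd_dvd2])
    hence "g * h dvd a" "g * h dvd b" "g * h dvd c" unfolding e by simp_all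
    hence "g * h dvd g" unfolding g_def by simp
    hence "g * h dvd g * 1" by simp
    thus ?thesis unfolding h_def[symmetric] using g0 by (simp only: dvd_mult_cancel_left) simp
  qed
  hence "coprime_vector a' b' c'" unfolding coprime_vector_def by simp
  with that[OF e g0] show thesis .
qed

lemma parallel_coprime_vector:
  assumes "coprime_vector a b c" "b * x = a * y" "c * x = a * z" "c * y = b * z"
  obtains m where "x = m * a" "y = m * b" "z = m * c"
proof -
  obtain p q where pq: "p * b + q * c = gcd b c" by (metis bezout_int)
  obtain r s where "r * a + s * gcd b c = 1"
    using assms(1) unfolding coprime_vector_def by (metis bezout_int)
  hence one: "r * a + s * p * b + s * q * c = 1" unfolding pq[symmetric] by (simp add: algebra_simps)
  define m where "m = r * x + s * p * y + s * q * z"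
  have "m * a = x" "m * b = y" "m * c = z" using assms(2-4) one unfolding m_def by algebra+
  thus thesis using that by metis
qed

text \<open>The integer combinations below are the components of the cross product with \<open>(a, b, c)\<close>.\<close>
lemma integer_points_separated:
  assumes cop: "coprime_vector a b c" and v: "v = t *\<^sub>R int_vec3 a b c" and proj: "projection_along v \<phi>"
  obtains \<delta> where "0 < \<delta>"
    "\<And>x y z. norm (\<phi> (int_vec3 x y z)) < \<delta> \<Longrightarrow> \<exists>m. x = m * a \<and> y = m * b \<and> z = m * c"
proof -
  define f1 f2 f3 :: "real ^ 3 \<Rightarrow> real" where
    "f1 w = of_int b * w $ 1 - of_int a * w $ 2" and
    "f2 w = of_int c * w $ 1 - of_int a * w $ 3" and
    "f3 w = of_int c * w $ 2 - of_int b * w $ 3" for w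
  have lin: "linear f1" "linear f2" "linear f3"
    unfolding f1_def f2_def f3_def by (auto intro!: linearI simp: algebra_simps)
  have zero: "f1 v = 0" "f2 v = 0" "f3 v = 0" unfolding f1_def f2_def f3_def v by simp_all
  obtain C1 where C1: "0 < C1" "\<And>x. \<bar>f1 x\<bar> \<le> C1 * norm (\<phi> x)"
    using projection_bounds_functional[OF proj lin(1) zero(1)] by blast
  obtain C2 where C2: "0 < C2" "\<And>x. \<bar>f2 x\<bar> \<le> C2 * norm (\<phi> x)"
    using projection_bounds_functional[OF proj lin(2) zero(2)] by blast
  obtain C3 where C3: "0 < C3" "\<And>x. \<bar>f3 x\<bar> \<le> C3 * norm (\<phi> x)"
    using projection_bounds_functional[OF proj lin(3) zero(3)] by blast
  define C where "C = C1 + C2 + C3"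
  have C: "0 < C" unfolding C_def using C1 C2 C3 by simp
  have "\<exists>m. x = m * a \<and> y = m * b \<and> z = m * c" if h: "norm (\<phi> (int_vec3 x y z)) < 1 / C" for x y z
  proof -
    define e where "e = norm (\<phi> (int_vec3 x y z))"
    have e: "0 \<le> e" "C * e < 1" using h C unfolding e_def by (simp_all add: field_simps)
    have "C1 * e \<le> C * e" "C2 * e \<le> C * e" "C3 * e \<le> C * e"
      using C1 C2 C3 e(1) unfolding C_def by (simp_all add: mult_right_mono)
    hence lt: "\<bar>f1 (int_vec3 x y z)\<bar> < 1" "\<bar>f2 (int_vec3 x y z)\<bar> < 1" "\<bar>f3 (int_vec3 x y z)\<bar> < 1"
      using C1(2) C2(2) C3(2) e(2) unfolding e_def by (meson le_less_trans)+
    have "f1 (int_vec3 x y z) = of_int (b * x - a * y)" "f2 (int_vec3 x y z) = of_int (c * x - a * z)"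
      "f3 (int_vec3 x y z) = of_int (c * y - b * z)"
      unfolding f1_def f2_def f3_def by simp_all
    hence "b * x = a * y" "c * x = a * z" "c * y = b * z" using lt by linarith+
    from parallel_coprime_vector[OF cop this] show ?thesis by metis
  qed
  with that[of "1 / C"] C show thesis by simp
qed

text \<open>Dirichlet's argument: modulo 1, \<open>M^3 + 1\<close> points are distributed over
  \<open>M^3\<close> cubes of side \<open>1 / M\<close>. The bound on \<open>j\<close> leaves
  finitely many pairs of indices, so parameters can be fixed before the pair is known.\<close>

lemma simultaneous_pigeonhole:
  fixes f g h :: "nat \<Rightarrow> real" and M :: nat
  assumes "0 < M"
  obtains i j :: nat and u v w :: int where "i < j" "j \<le> M ^ 3"
    "\<bar>f j - f i - of_int u\<bar> < 1 / M" "\<bar>g j - g i - of_int v\<bar> < 1 / M" "\<bar>h j - h i - of_int w\<bar> < 1 / M"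
proof -
  define c where "c x = \<lfloor>real M * frac x\<rfloor>" for x :: real
  define F where "F i = (c (f i), c (g i), c (h i))" for i
  have c: "c x \<in> {0..<int M}" for x
    using assms frac_lt_1[of x] frac_ge_0[of x] unfolding c_def by (simp add: floor_less_iff)
  have "card (F ` {..M ^ 3}) \<le> card ({0..<int M} \<times> {0..<int M} \<times> {0..<int M})"
    by (intro card_mono) (auto simp: F_def c simp del: atLeastLessThan_iff)
  also have "\<dots> = M ^ 3" by (simp add: card_cartesian_product power3_eq_cube)
  finally have "card (F ` {..M ^ 3}) < card {..M ^ 3}" by simp
  hence "\<not> inj_on F {..M ^ 3}" by (rule pigeonhole)
  then obtain i' j' where ij': "i' \<le> M ^ 3" "j' \<le> M ^ 3" "F i' = F j'" "i' \<noteq> j'"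
    unfolding inj_on_def by auto
  then obtain i j where ij: "i < j" "j \<le> M ^ 3" "F i = F j" by (metis linorder_neqE_nat)
  have close: "\<bar>x - y - of_int (\<lfloor>x\<rfloor> - \<lfloor>y\<rfloor>)\<bar> < 1 / M" if "c x = c y" for x y
  proof -
    have "\<bar>real M * frac x - real M * frac y\<bar> < 1"
      using that unfolding c_def by linarith
    moreover have "real M * frac x - real M * frac y = real M * (x - y - of_int (\<lfloor>x\<rfloor> - \<lfloor>y\<rfloor>))"
      unfolding frac_def by (simp add: algebra_simps)
    ultimately have "real M * \<bar>x - y - of_int (\<lfloor>x\<rfloor> - \<lfloor>y\<rfloor>)\<bar> < 1" by (simp add: abs_mult)
    thus ?thesis using assms by (simp add: field_simps)
  qed
  show thesis using that[OF ij(1,2) close close close] ij(3) unfolding F_def by simp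
qed

text \<open>The distance to the nearest integer is positive, so scaling makes it exceed 1. This
  later keeps approximating integer vectors from being divisible by a high power of
  \<open>k\<close>.\<close>

lemma not_Ints_separated:
  fixes \<beta> b :: real
  assumes "\<beta> \<notin> \<int>" "1 < b"
  obtains J where "\<And>a n. J \<le> n \<Longrightarrow> 1 < b ^ n * \<bar>\<beta> - of_int a\<bar>"
proof -
  define \<eta> where "\<eta> = \<bar>\<beta> - of_int (round \<beta>)\<bar>"
  have \<eta>: "\<eta> > 0" using assms(1) unfolding \<eta>_def by (metis Ints_of_int eq_iff_diff_eq_0 zero_less_abs_iff)
  obtain J where J: "1 / \<eta> < b ^ J" using real_arch_pow[OF assms(2)] by blast
  have "1 < b ^ n * \<bar>\<beta> - of_int a\<bar>" if "J \<le> n" for a n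
  proof -
    have "1 < b ^ J * \<eta>" using J \<eta> by (simp add: field_simps)
    also have "\<dots> \<le> b ^ n * \<bar>\<beta> - of_int a\<bar>"
    proof (intro mult_mono power_increasing)
      show "\<eta> \<le> \<bar>\<beta> - of_int a\<bar>" unfolding \<eta>_def by (metis abs_minus_commute round_diff_minimal)
    qed (use that assms \<eta> in auto)
    finally show ?thesis .
  qed
  thus thesis using that by blast
qed

section \<open>Digits and their differences\<close>

locale digit_system =
  fixes k l :: int
  assumes k_ge: "2 \<le> k" and l_ge: "0 \<le> l" and l_less: "2 * l < k"
begin

definition digits :: "(int \<times> int \<times> int) set" where
  "digits = {(x, y, z). x \<in> {0..k - 1} \<and> y \<in> {0..k - 1} \<and> z \<in> {0..k - 1} \<and>
     k dvd x + y + z - (l - 1)}"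

fun expansions :: "nat \<Rightarrow> (int \<times> int \<times> int) set" where
  "expansions 0 = {(0, 0, 0)}"
| "expansions (Suc n) =
     (\<lambda>((x, y, z), (x', y', z')). (x + k * x', y + k * y', z + k * z')) ` (digits \<times> expansions n)"

definition digit_diff :: "int \<Rightarrow> int \<Rightarrow> int \<Rightarrow> bool" where
  "digit_diff x y z \<longleftrightarrow>
     (\<exists>p q r p' q' r'. (p, q, r) \<in> digits \<and> (p', q', r') \<in> digits \<and>
        x = p - p' \<and> y = q - q' \<and> z = r - r')"

definition expansion_diff :: "int \<Rightarrow> int \<Rightarrow> int \<Rightarrow> bool" where
  "expansion_diff x y z \<longleftrightarrow>
     (\<exists>n p q r p' q' r'. (p, q, r) \<in> expansions n \<and> (p', q', r') \<in> expansions n \<and>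
        x = p - p' \<and> y = q - q' \<and> z = r - r')"

lemma expansion_diff_zero: "expansion_diff 0 0 0"
  unfolding expansion_diff_def by (rule exI[of _ 0]) auto

lemma expansion_diff_step:
  assumes "digit_diff (x - k * x1) (y - k * y1) (z - k * z1)" "expansion_diff x1 y1 z1"
  shows "expansion_diff x y z"
proof -
  obtain p q r p' q' r' where d: "(p, q, r) \<in> digits" "(p', q', r') \<in> digits"
    "x - k * x1 = p - p'" "y - k * y1 = q - q'" "z - k * z1 = r - r'"
    using assms(1) unfolding digit_diff_def by blast
  obtain n a b c a' b' c' where e: "(a, b, c) \<in> expansions n" "(a', b', c') \<in> expansions n"
    "x1 = a - a'" "y1 = b - b'" "z1 = c - c'"
    using assms(2) unfolding expansion_diff_def by blast
  have 1: "(p + k * a, q + k * b, r + k * c) \<in> expansions (Suc n)"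
    using d(1) e(1) by force
  have 2: "(p' + k * a', q' + k * b', r' + k * c') \<in> expansions (Suc n)"
    using d(2) e(2) by force
  have "x = p + k * a - (p' + k * a')" "y = q + k * b - (q' + k * b')" "z = r + k * c - (r' + k * c')"
    using d(3-5) e(3-5) by (simp_all add: algebra_simps)
  with 1 2 show ?thesis unfolding expansion_diff_def by blast
qed

lemma digit_diff_bound:
  assumes "digit_diff x y z"
  shows "\<bar>x\<bar> \<le> k - 1" "\<bar>y\<bar> \<le> k - 1" "\<bar>z\<bar> \<le> k - 1"
  using assms unfolding digit_diff_def digits_def by auto

lemma digit_diff_minus:
  assumes "digit_diff x y z" shows "digit_diff (-x) (-y) (-z)"
proof -
  obtain p q r p' q' r' where d: "(p, q, r) \<in> digits" "(p', q', r') \<in> digits"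
    "x = p - p'" "y = q - q'" "z = r - r'"
    using assms unfolding digit_diff_def by blast
  have "-x = p' - p" "-y = q' - q" "-z = r' - r" using d by simp_all
  with d(1,2) show ?thesis unfolding digit_diff_def by blast
qed

lemma digits_swap:
  "(p, q, r) \<in> digits \<Longrightarrow> (q, p, r) \<in> digits"
  "(p, q, r) \<in> digits \<Longrightarrow> (p, r, q) \<in> digits"
  unfolding digits_def by (simp_all add: ac_simps)

lemma digit_diff_swap12: "digit_diff x y z \<Longrightarrow> digit_diff y x z"
  unfolding digit_diff_def using digits_swap(1) by blast

lemma digit_diff_swap23: "digit_diff x y z \<Longrightarrow> digit_diff x z y"
  unfolding digit_diff_def using digits_swap(2) by blast

text \<open>The sums of the admissible subtrahends fill an interval; it only has to meet the residue
  class of \<open>l - 1\<close>.\<close>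
lemma digit_diffI:
  assumes b: "\<bar>x\<bar> \<le> k - 1" "\<bar>y\<bar> \<le> k - 1" "\<bar>z\<bar> \<le> k - 1" and dv: "k dvd x + y + z"
    and t: "max 0 (-x) + max 0 (-y) + max 0 (-z) \<le> t"
      "t \<le> 3 * (k - 1) - max 0 x - max 0 y - max 0 z"
    and tl: "k dvd t - (l - 1)"
  shows "digit_diff x y z"
proof -
  have split: "\<exists>p q. a \<le> p \<and> p \<le> a' \<and> c \<le> q \<and> q \<le> c' \<and> p + q = s"
    if "a \<le> a'" "c \<le> c'" "a + c \<le> s" "s \<le> a' + c'" for a a' c c' s :: int
  proof (cases "s - c' \<le> a")
    case True thus ?thesis using that by (intro exI[of _ a] exI[of _ "s - a"]) auto
  next
    case False thus ?thesis using that by (intro exI[of _ "s - c'"] exI[of _ c']) auto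
  qed
  \<comment> \<open>\<open>[X, X']\<close> is the range of those \<open>p\<close> for which
    \<open>p\<close> and \<open>p + x\<close> both lie in \<open>0..k - 1\<close>; likewise for
    \<open>Y\<close> and \<open>Z\<close>.\<close>
  define X Y Z where "X = max 0 (-x)" and "Y = max 0 (-y)" and "Z = max 0 (-z)"
  define X' Y' Z' where "X' = k - 1 - max 0 x" and "Y' = k - 1 - max 0 y" and "Z' = k - 1 - max 0 z"
  have X: "0 \<le> X" "0 \<le> X + x" "X' \<le> k - 1" "X' + x \<le> k - 1" "X \<le> X'"
    using b(1) unfolding X_def X'_def by linarith+
  have Y: "0 \<le> Y" "0 \<le> Y + y" "Y' \<le> k - 1" "Y' + y \<le> k - 1" "Y \<le> Y'"
    using b(2) unfolding Y_def Y'_def by linarith+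
  have Z: "0 \<le> Z" "0 \<le> Z + z" "Z' \<le> k - 1" "Z' + z \<le> k - 1" "Z \<le> Z'"
    using b(3) unfolding Z_def Z'_def by linarith+
  have T: "X + (Y + Z) \<le> t" "t \<le> X' + (Y' + Z')"
    using t unfolding X_def Y_def Z_def X'_def Y'_def Z'_def by simp_all
  obtain p u where p: "X \<le> p" "p \<le> X'" and u: "Y + Z \<le> u" "u \<le> Y' + Z'" and pu: "p + u = t"
    using split[of X X' "Y + Z" "Y' + Z'" t] T X(5) Y(5) Z(5) by auto
  obtain q r where q: "Y \<le> q" "q \<le> Y'" and r: "Z \<le> r" "r \<le> Z'" and qr: "q + r = u"
    using split[OF Y(5) Z(5) u] by auto
  have s: "p + q + r = t" using pu qr by simp
  have "(p, q, r) \<in> digits" using X Y Z p q r tl s unfolding digits_def by simp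
  moreover have "(p + x, q + y, r + z) \<in> digits"
  proof -
    have "p + x + (q + y) + (r + z) - (l - 1) = (x + y + z) + (t - (l - 1))" using s by simp
    hence "k dvd p + x + (q + y) + (r + z) - (l - 1)" using dvd_add[OF dv tl] by metis
    thus ?thesis using X Y Z p q r unfolding digits_def by simp
  qed
  moreover have "x = p + x - p" "y = q + y - q" "z = r + z - r" by simp_all
  ultimately show ?thesis unfolding digit_diff_def by blast
qed

text \<open>The interval of admissible subtrahend sums has length
  \<open>3 (k - 1) - (|x| + |y| + |z|) >= k - 1\<close>, so it contains \<open>k\<close> consecutive
  integers and meets every residue class.\<close>

lemma digit_diff_small:
  assumes b: "\<bar>x\<bar> \<le> k - 1" "\<bar>y\<bar> \<le> k - 1" "\<bar>z\<bar> \<le> k - 1" and dv: "k dvd x + y + z"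
    and s: "\<bar>x\<bar> + \<bar>y\<bar> + \<bar>z\<bar> \<le> 2 * k - 2"
  shows "digit_diff x y z"
proof -
  define L where "L = max 0 (-x) + max 0 (-y) + max 0 (-z)"
  define m where "m = (l - 1 - L) mod k"
  have m: "0 \<le> m" "m \<le> k - 1" using k_ge unfolding m_def by (simp_all add: zle_diff1_eq)
  have "L + m - (l - 1) = - ((l - 1 - L) - (l - 1 - L) mod k)" unfolding m_def by simp
  hence "k dvd L + m - (l - 1)" by (metis dvd_minus_iff dvd_minus_mod)
  moreover have "max 0 a + max 0 (-a) = \<bar>a\<bar>" for a :: int by simp
  hence "L + (max 0 x + max 0 y + max 0 z) = \<bar>x\<bar> + \<bar>y\<bar> + \<bar>z\<bar>"
    unfolding L_def by (metis (no_types, lifting) add.assoc add.commute)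
  hence "L + m \<le> 3 * (k - 1) - max 0 x - max 0 y - max 0 z"
    using m(2) s by (simp add: algebra_simps)
  moreover have "L \<le> L + m" using m by simp
  ultimately show ?thesis using digit_diffI[OF b dv, of "L + m"] unfolding L_def by blast
qed

section \<open>Splitting off the lowest digit with prescribed coordinate sum\<close>

lemma step_zero_aux:
  assumes s: "p + q + r = k * n" "n = 1 \<or> n = 2"
    and b: "0 \<le> p" "p < k" "0 \<le> q" "q < k" "0 \<le> r" "r < k"
  shows "1 \<le> p \<Longrightarrow> digit_diff (p - k * (if n = 1 then 1 else 0)) (q - k * (n - 1)) (r - k * (n - 1))"
  using s(2)
proof
  \<comment> \<open>The digit difference is \<open>(p - k, q, r)\<close> here and
    \<open>(p, q - k, r - k)\<close> below; both have sum zero, and absolute values adding up to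
    \<open>2 (k - p)\<close> respectively \<open>2 p\<close>, at most
    \<open>2 k - 2\<close>.\<close>
  assume "1 \<le> p" "n = 1" then show ?thesis using s b k_ge by (intro digit_diff_small) auto
next
  assume "1 \<le> p" and n: "n = 2"
  have "k dvd p + (q - k) + (r - k)" using s n by (simp add: algebra_simps)
  then show ?thesis using s b n by simp (intro digit_diff_small, auto)
qed

text \<open>Covers at once the zero residue and the exceptional residues \<open>(1, 1, 1)\<close>
  and \<open>(2, 2, 2)\<close>. A vector that is not aligned and has coordinate sum divisible by
  \<open>k\<close> admits every kind of step, and the quotient in \<open>step_zero\<close> can be
  chosen not aligned again.\<close>

definition aligned :: "int \<Rightarrow> int \<Rightarrow> int \<Rightarrow> bool" where
  "aligned x y z \<longleftrightarrow> k dvd x - y \<and> k dvd y - z"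

text \<open>The candidate quotients in \<open>step_zero\<close> differ by moving a unit from one
  coordinate to another, which changes a difference of coordinates by 1; so no two of them are both
  aligned.\<close>

lemma aligned_shift:
  "aligned x y z \<Longrightarrow> aligned (x + 1) y (z - 1) \<Longrightarrow> False"
  "aligned x y z \<Longrightarrow> aligned (x + 1) (y - 1) z \<Longrightarrow> False"
  "aligned x y z \<Longrightarrow> aligned x (y + 1) (z - 1) \<Longrightarrow> False"
proof -
  have *: "\<not> k dvd 1" using k_ge by (simp add: zdvd_not_zless)
  show "aligned x y z \<Longrightarrow> aligned (x + 1) y (z - 1) \<Longrightarrow> False"
  proof -
    assume "aligned x y z" "aligned (x + 1) y (z - 1)"
    hence "k dvd (x + 1 - y) - (x - y)" unfolding aligned_def by (metis dvd_diff)
    thus False using * by simp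
  qed
  show "aligned x y z \<Longrightarrow> aligned (x + 1) (y - 1) z \<Longrightarrow> False"
  proof -
    assume "aligned x y z" "aligned (x + 1) (y - 1) z"
    hence "k dvd (y - z) - (y - 1 - z)" unfolding aligned_def by (metis dvd_diff)
    thus False using * by simp
  qed
  show "aligned x y z \<Longrightarrow> aligned x (y + 1) (z - 1) \<Longrightarrow> False"
  proof -
    assume "aligned x y z" "aligned x (y + 1) (z - 1)"
    hence "k dvd (x - y) - (x - (y + 1))" unfolding aligned_def by (metis dvd_diff)
    thus False using * by simp
  qed
qed

lemma residue_decomp:
  assumes "k dvd x + y + z" "\<not> (k dvd x \<and> k dvd y \<and> k dvd z)"
  obtains p q r u v w n where "x = p + k * u" "y = q + k * v" "z = r + k * w"
    "0 \<le> p" "p < k" "0 \<le> q" "q < k" "0 \<le> r" "r < k" "p + q + r = k * n" "n = 1 \<or> n = 2"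
    "p = x mod k" "q = y mod k" "r = z mod k"
proof -
  have d: "x = x mod k + k * (x div k)" "y = y mod k + k * (y div k)" "z = z mod k + k * (z div k)"
    by simp_all
  have b: "0 \<le> x mod k" "x mod k < k" "0 \<le> y mod k" "y mod k < k" "0 \<le> z mod k" "z mod k < k"
    using k_ge by simp_all
  have "k dvd x mod k + y mod k + z mod k"
    using assms(1) by (metis dvd_eq_mod_eq_0 mod_add_eq mod_add_left_eq)
  then obtain n where n: "x mod k + y mod k + z mod k = k * n" by (elim dvdE)
  have "k * n < k * 3" using n b by linarith
  hence n3: "n < 3" using k_ge by simp
  have "0 < x mod k + y mod k + z mod k"
    using assms(2) b by (smt (verit) dvd_eq_mod_eq_0)
  hence n0: "0 < n" using n k_ge by (simp add: zero_less_mult_iff)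
  have "n = 1 \<or> n = 2" using n0 n3 by auto
  from that[OF d b n this refl refl refl] show thesis .
qed

text \<open>Each nonzero residue offers a digit difference of sum zero. The residues are below
  \<open>k\<close> and add up to at least \<open>k\<close>, so two of them are nonzero, and of the
  two quotients at most one is aligned.\<close>

lemma step_zero:
  assumes "k dvd x + y + z" "\<not> (k dvd x \<and> k dvd y \<and> k dvd z)"
  obtains x1 y1 z1 where "digit_diff (x - k * x1) (y - k * y1) (z - k * z1)"
    "k * (x1 + y1 + z1) = x + y + z" "\<not> aligned x1 y1 z1"
proof -
  obtain p q r u v w n where e: "x = p + k * u" "y = q + k * v" "z = r + k * w"
    and b: "0 \<le> p" "p < k" "0 \<le> q" "q < k" "0 \<le> r" "r < k" and n: "p + q + r = k * n" "n = 1 \<or> n = 2"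
    and "p = x mod k" "q = y mod k" "r = z mod k"
    by (rule residue_decomp[OF assms])
  \<comment> \<open>The distinguished coordinate gets the carry \<open>i\<close>, the other two get
    \<open>j\<close>: \<open>(i, j)\<close> is \<open>(1, 0)\<close> if the residues add up to
    \<open>k\<close> and \<open>(0, 1)\<close> if they add up to \<open>2 k\<close>.\<close>
  define i j where "i = (if n = 1 then 1 else 0 :: int)" and "j = n - 1"
  have ij: "i = j + 1 \<or> j = i + 1" "i + 2 * j = n" using n(2) unfolding i_def j_def by auto
  have A: "digit_diff (x - k * (u + i)) (y - k * (v + j)) (z - k * (w + j))" if "1 \<le> p"
    using step_zero_aux[OF n b that] e unfolding i_def j_def by (simp add: algebra_simps)
  have B: "digit_diff (x - k * (u + j)) (y - k * (v + i)) (z - k * (w + j))" if "1 \<le> q"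
  proof -
    have "q + p + r = k * n" using n by simp
    from digit_diff_swap12[OF step_zero_aux[OF this n(2) b(3,4,1,2,5,6) that]]
    show ?thesis using e unfolding i_def j_def by (simp add: algebra_simps)
  qed
  have C: "digit_diff (x - k * (u + j)) (y - k * (v + j)) (z - k * (w + i))" if "1 \<le> r"
  proof -
    have "r + p + q = k * n" using n by simp
    from digit_diff_swap23[OF digit_diff_swap12[OF step_zero_aux[OF this n(2) b(5,6,1,2,3,4) that]]]
    show ?thesis using e unfolding i_def j_def by (simp add: algebra_simps)
  qed
  have sm: "k * (u + i + (v + j) + (w + j)) = x + y + z" "k * (u + j + (v + i) + (w + j)) = x + y + z"
    "k * (u + j + (v + j) + (w + i)) = x + y + z"
    using e n(1) ij(2) by algebra+
  have "k \<le> k * n" using n(2) k_ge by auto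
  hence gt: "(1 \<le> p \<and> 1 \<le> q) \<or> (1 \<le> p \<and> 1 \<le> r) \<or> (1 \<le> q \<and> 1 \<le> r)"
    using n(1) b by linarith
  have "\<not> aligned (u + i) (v + j) (w + j) \<or> \<not> aligned (u + j) (v + i) (w + j)"
    using ij(1) aligned_shift(2)[of "u + j" "v + i" "w + j"] aligned_shift(2)[of "u + i" "v + j" "w + j"]
    by (auto simp: algebra_simps)
  moreover have "\<not> aligned (u + i) (v + j) (w + j) \<or> \<not> aligned (u + j) (v + j) (w + i)"
    using ij(1) aligned_shift(1)[of "u + j" "v + j" "w + i"] aligned_shift(1)[of "u + i" "v + j" "w + j"]
    by (auto simp: algebra_simps)
  moreover have "\<not> aligned (u + j) (v + i) (w + j) \<or> \<not> aligned (u + j) (v + j) (w + i)"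
    using ij(1) aligned_shift(3)[of "u + j" "v + j" "w + i"] aligned_shift(3)[of "u + j" "v + i" "w + j"]
    by (auto simp: algebra_simps)
  ultimately show thesis using gt A B C sm that by metis
qed

text \<open>For \<open>(p - k, q, r)\<close> the admissible subtrahend sums run from
  \<open>k - p\<close> to \<open>k + p - 3\<close>; the representative \<open>l - 1 + k\<close> lies
  among them as soon as \<open>p >= l + 2\<close>.\<close>

lemma step_plus_aux:
  assumes n: "p + q + r = k * 2"
    and b: "0 \<le> p" "p < k" "0 \<le> q" "q < k" "0 \<le> r" "r < k" and "l + 2 \<le> p"
  shows "digit_diff (p - k) q r"
proof (rule digit_diffI)
  show "k dvd p - k + q + r" using n by (simp add: algebra_simps)
  show "k dvd (l - 1 + k) - (l - 1)" by simp
qed (use assms l_ge in auto)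

text \<open>A digit difference of coordinate sum \<open>k\<close> lowers the sum of the quotient by
  one. Residues adding up to \<open>k\<close> serve themselves; if they add up to
  \<open>2 k\<close>, then \<open>k\<close> is subtracted from one that is at least
  \<open>l + 2\<close>.\<close>

lemma step_plus:
  assumes "k dvd x + y + z" "\<not> (k dvd x \<and> k dvd y \<and> k dvd z)"
    and ex: "\<not> (k = 3 \<and> l = 1 \<and> x mod 3 = 2 \<and> y mod 3 = 2 \<and> z mod 3 = 2)"
  obtains x1 y1 z1 where "digit_diff (x - k * x1) (y - k * y1) (z - k * z1)"
    "k * (x1 + y1 + z1) = x + y + z - k"
proof -
  obtain p q r u v w n where e: "x = p + k * u" "y = q + k * v" "z = r + k * w"
    and b: "0 \<le> p" "p < k" "0 \<le> q" "q < k" "0 \<le> r" "r < k" and n: "p + q + r = k * n" "n = 1 \<or> n = 2"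
    and m: "p = x mod k" "q = y mod k" "r = z mod k"
    by (rule residue_decomp[OF assms(1,2)])
  from n(2) show thesis
  proof
    assume n1: "n = 1"
    have "digit_diff p q r" using n n1 b k_ge by (intro digit_diff_small) auto
    thus thesis using that[of u v w] e n n1 by (simp add: algebra_simps)
  next
    assume n2: "n = 2"
    have "l + 2 \<le> p \<or> l + 2 \<le> q \<or> l + 2 \<le> r"
    proof (rule ccontr)
      assume "\<not> ?thesis"
      \<comment> \<open>The exception arises here: \<open>2 k <= 3 (l + 1)\<close>,
        \<open>2 l < k\<close> and \<open>k >= 2\<close> leave only \<open>k = 3\<close>,
        \<open>l = 1\<close> with all residues equal to 2.\<close>
      hence c: "p \<le> l + 1" "q \<le> l + 1" "r \<le> l + 1" by auto
      have s2: "p + q + r = k * 2" using n n2 by simp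
      have "k \<le> 3" using c s2 l_less by linarith
      hence "l = 1" using c s2 l_less k_ge by linarith
      hence "k = 3" using \<open>k \<le> 3\<close> l_less by linarith
      hence "p = 2" "q = 2" "r = 2" using c s2 \<open>l = 1\<close> by linarith+
      thus False using ex m \<open>k = 3\<close> \<open>l = 1\<close> by simp
    qed
    moreover have nn: "p + q + r = k * 2" "q + p + r = k * 2" "r + p + q = k * 2" using n n2 by auto
    ultimately consider "digit_diff (p - k) q r" | "digit_diff p (q - k) r" | "digit_diff p q (r - k)"
      using step_plus_aux[OF nn(1) b] digit_diff_swap12[OF step_plus_aux[OF nn(2) b(3,4,1,2,5,6)]]
        digit_diff_swap23[OF digit_diff_swap12[OF step_plus_aux[OF nn(3) b(5,6,1,2,3,4)]]] by blast
    thus thesis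
      using that[of "u + 1" v w] that[of u "v + 1" w] that[of u v "w + 1"] e nn
      by cases (auto simp: algebra_simps)
  qed
qed

lemma step_minus:
  assumes "k dvd x + y + z" "\<not> (k dvd x \<and> k dvd y \<and> k dvd z)"
    and ex: "\<not> (k = 3 \<and> l = 1 \<and> x mod 3 = 1 \<and> y mod 3 = 1 \<and> z mod 3 = 1)"
  obtains x1 y1 z1 where "digit_diff (x - k * x1) (y - k * y1) (z - k * z1)"
    "k * (x1 + y1 + z1) = x + y + z + k"
proof -
  have "k dvd (-x) + (-y) + (-z)" using assms(1) by (metis dvd_minus_iff minus_add_distrib)
  moreover have "\<not> (k dvd -x \<and> k dvd -y \<and> k dvd -z)" using assms(2) by simp
  moreover have "\<not> (k = 3 \<and> l = 1 \<and> (-x) mod 3 = 2 \<and> (-y) mod 3 = 2 \<and> (-z) mod 3 = 2)"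
    using ex by presburger
  ultimately obtain x1 y1 z1 where "digit_diff (-x - k * x1) (-y - k * y1) (-z - k * z1)"
    "k * (x1 + y1 + z1) = -x + -y + -z - k" using step_plus by metis
  with digit_diff_minus[OF this(1)] that[of "-x1" "-y1" "-z1"] show thesis
    by (simp add: algebra_simps)
qed

section \<open>Differences of expansions\<close>

lemma digit_diff_zero: "digit_diff 0 0 0"
  using k_ge by (intro digit_diff_small) auto

lemma expansion_diff_mult: "expansion_diff x y z \<Longrightarrow> expansion_diff (k * x) (k * y) (k * z)"
  by (rule expansion_diff_step[of _ x _ y _ z]) (simp_all add: digit_diff_zero)

text \<open>Steps of digit sum zero keep the coordinate sum zero and shrink the coordinates until
  they are bounded by 1; such a vector is itself a digit difference.\<close>

lemma expansion_diff_sum_zero: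
  assumes "x + y + z = 0"
  shows "expansion_diff x y z"
proof -
  have "expansion_diff x y z"
    if "x + y + z = 0" "\<bar>x\<bar> \<le> 1 + int N" "\<bar>y\<bar> \<le> 1 + int N" "\<bar>z\<bar> \<le> 1 + int N" for N x y z
    using that
  proof (induction N arbitrary: x y z)
    case 0
    have "digit_diff (x - k * 0) (y - k * 0) (z - k * 0)"
      using 0 k_ge by (intro digit_diff_small) auto
    thus ?case using expansion_diff_zero by (rule expansion_diff_step)
  next
    case (Suc N)
    have shrink: "\<bar>b\<bar> \<le> 1 + int N" if "\<bar>a - k * b\<bar> \<le> k - 1" "\<bar>a\<bar> \<le> 1 + int (Suc N)" for a b
    proof (rule ccontr)
      assume "\<not> ?thesis"
      hence "k * (2 + int N) \<le> k * \<bar>b\<bar>" using k_ge by (intro mult_left_mono) auto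
      moreover have "k * \<bar>b\<bar> = \<bar>k * b\<bar>" using k_ge by (simp add: abs_mult)
      ultimately have "2 * k + k * int N \<le> k + 1 + int N" using that by (simp add: algebra_simps)
      moreover have "int N \<le> k * int N" using k_ge by (simp add: mult_le_cancel_right1)
      ultimately show False using k_ge by linarith
    qed
    obtain x1 y1 z1 where 1: "digit_diff (x - k * x1) (y - k * y1) (z - k * z1)"
      "k * (x1 + y1 + z1) = 0"
    proof (cases "k dvd x \<and> k dvd y \<and> k dvd z")
      case True
      then obtain x1 y1 z1 where e: "x = k * x1" "y = k * y1" "z = k * z1" by (elim conjE dvdE)
      show thesis using Suc.prems(1) e digit_diff_zero
        by (intro that[of x1 y1 z1]) (simp_all add: distrib_left)
    next
      case False
      have "k dvd x + y + z" using Suc.prems(1) by simp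
      from step_zero[OF this False] show thesis using that Suc.prems(1) by metis
    qed
    have "x1 + y1 + z1 = 0" using 1(2) k_ge by simp
    moreover note shrink[OF digit_diff_bound(1)[OF 1(1)]] shrink[OF digit_diff_bound(2)[OF 1(1)]]
      shrink[OF digit_diff_bound(3)[OF 1(1)]]
    ultimately have "expansion_diff x1 y1 z1" using Suc.IH Suc.prems by blast
    with 1(1) show ?case by (rule expansion_diff_step)
  qed
  note this[of x y z "nat (\<bar>x\<bar> + \<bar>y\<bar> + \<bar>z\<bar>)"]
  thus ?thesis using assms by simp
qed

definition plus_ok :: "int \<Rightarrow> int \<Rightarrow> int \<Rightarrow> bool" where
  "plus_ok x y z \<longleftrightarrow> \<not> (k dvd x \<and> k dvd y \<and> k dvd z) \<and>
     \<not> (k = 3 \<and> l = 1 \<and> x mod 3 = 2 \<and> y mod 3 = 2 \<and> z mod 3 = 2)"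

definition minus_ok :: "int \<Rightarrow> int \<Rightarrow> int \<Rightarrow> bool" where
  "minus_ok x y z \<longleftrightarrow> \<not> (k dvd x \<and> k dvd y \<and> k dvd z) \<and>
     \<not> (k = 3 \<and> l = 1 \<and> x mod 3 = 1 \<and> y mod 3 = 1 \<and> z mod 3 = 1)"

lemma not_aligned_ok:
  assumes "\<not> aligned x y z"
  shows "\<not> (k dvd x \<and> k dvd y \<and> k dvd z)" "plus_ok x y z" "minus_ok x y z"
proof -
  show nz: "\<not> (k dvd x \<and> k dvd y \<and> k dvd z)"
    using assms unfolding aligned_def by (metis dvd_diff)
  have "\<not> (k = 3 \<and> x mod 3 = y mod 3 \<and> y mod 3 = z mod 3)"
    using assms unfolding aligned_def by (metis mod_eq_dvd_iff)
  thus "plus_ok x y z" "minus_ok x y z" using nz unfolding plus_ok_def minus_ok_def by auto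
qed

lemma expansion_diff_sum_k:
  assumes "x + y + z = k" "plus_ok x y z"
  shows "expansion_diff x y z"
proof -
  have "k dvd x + y + z" using assms(1) by simp
  then obtain x1 y1 z1 where "digit_diff (x - k * x1) (y - k * y1) (z - k * z1)"
    "k * (x1 + y1 + z1) = x + y + z - k"
    using assms(2) unfolding plus_ok_def by (metis step_plus)
  thus ?thesis
    using assms(1) k_ge by (intro expansion_diff_step[OF _ expansion_diff_sum_zero]) auto
qed

text \<open>Steps of digit sum zero divide the coordinate sum by \<open>k\<close> and preserve
  non-alignment, until the sum is \<open>k\<close>.\<close>

lemma expansion_diff_sum_power_aux:
  assumes "x + y + z = k ^ Suc N" "\<not> aligned x y z"
  shows "expansion_diff x y z"
  using assms
proof (induction N arbitrary: x y z)
  case 0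
  thus ?case using expansion_diff_sum_k not_aligned_ok(2) by simp
next
  case (Suc N)
  have "k dvd x + y + z" using Suc.prems(1) by simp
  then obtain x1 y1 z1 where 1: "digit_diff (x - k * x1) (y - k * y1) (z - k * z1)"
    "k * (x1 + y1 + z1) = x + y + z" "\<not> aligned x1 y1 z1"
    using not_aligned_ok(1)[OF Suc.prems(2)] by (metis step_zero)
  have "x1 + y1 + z1 = k ^ Suc N" using 1(2) Suc.prems(1) k_ge by simp
  from expansion_diff_step[OF 1(1) Suc.IH[OF this 1(3)]] show ?case .
qed

text \<open>Common factors \<open>k\<close> are removed first. The divisibility hypothesis stops
  this while the sum is still at least \<open>k^2\<close>, which leaves room for a step of digit sum
  zero that makes the vector non-aligned.\<close>

lemma expansion_diff_sum_power:
  assumes "x + y + z = k ^ Suc N" "\<not> (k ^ N dvd x \<and> k ^ N dvd y \<and> k ^ N dvd z)"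
  shows "expansion_diff x y z"
  using assms
proof (induction N arbitrary: x y z)
  case 0
  thus ?case by simp
next
  case (Suc N)
  have d: "k dvd x + y + z" using Suc.prems(1) by simp
  show ?case
  proof (cases "k dvd x \<and> k dvd y \<and> k dvd z")
    case True
    then obtain x1 y1 z1 where e: "x = k * x1" "y = k * y1" "z = k * z1" by (elim conjE dvdE)
    have "k * (x1 + y1 + z1) = k * k ^ Suc N" using Suc.prems(1) e by (simp add: distrib_left)
    hence "x1 + y1 + z1 = k ^ Suc N" using k_ge by simp
    moreover have "\<not> (k ^ N dvd x1 \<and> k ^ N dvd y1 \<and> k ^ N dvd z1)"
      using Suc.prems(2) e by auto
    ultimately show ?thesis using Suc.IH expansion_diff_mult e by blast
  next
    case False
    with d obtain x1 y1 z1 where 1: "digit_diff (x - k * x1) (y - k * y1) (z - k * z1)"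
      "k * (x1 + y1 + z1) = x + y + z" "\<not> aligned x1 y1 z1"
      by (metis step_zero)
    have "x1 + y1 + z1 = k ^ Suc N" using 1(2) Suc.prems(1) k_ge by simp
    from expansion_diff_step[OF 1(1) expansion_diff_sum_power_aux[OF this 1(3)]] show ?thesis .
  qed
qed

text \<open>A condition inherited when the lowest digit is split off; for \<open>A = 0\<close> it says that \<open>k\<^sup>n\<close> does not
  divide \<open>(x, y, z)\<close>.\<close>
definition far :: "nat \<Rightarrow> nat \<Rightarrow> int \<Rightarrow> int \<Rightarrow> int \<Rightarrow> bool" where
  "far A n x y z \<longleftrightarrow> \<not> (\<exists>a b c. \<bar>x - k ^ (A + n) * a\<bar> \<le> k ^ A - 1 \<and>
     \<bar>y - k ^ (A + n) * b\<bar> \<le> k ^ A - 1 \<and> \<bar>z - k ^ (A + n) * c\<bar> \<le> k ^ A - 1)"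

text \<open>The bounds fit together because
  \<open>(k - 1) + k (k^A - 1) = k^(A+1) - 1\<close>.\<close>

lemma far_step:
  assumes "far (Suc A) n x y z" "digit_diff (x - k * x1) (y - k * y1) (z - k * z1)"
  shows "far A n x1 y1 z1"
  unfolding far_def
proof (intro notI, elim exE conjE)
  fix a b c
  assume 1: "\<bar>x1 - k ^ (A + n) * a\<bar> \<le> k ^ A - 1" "\<bar>y1 - k ^ (A + n) * b\<bar> \<le> k ^ A - 1"
    "\<bar>z1 - k ^ (A + n) * c\<bar> \<le> k ^ A - 1"
  have "\<bar>u - k ^ (Suc A + n) * d\<bar> \<le> k ^ Suc A - 1"
    if "\<bar>v - k ^ (A + n) * d\<bar> \<le> k ^ A - 1" "\<bar>u - k * v\<bar> \<le> k - 1" for u v d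
  proof -
    have "u - k ^ (Suc A + n) * d = (u - k * v) + k * (v - k ^ (A + n) * d)"
      by (simp add: algebra_simps)
    moreover have "\<bar>k * (v - k ^ (A + n) * d)\<bar> \<le> k * (k ^ A - 1)"
      unfolding abs_mult using that(1) k_ge by simp
    ultimately have "\<bar>u - k ^ (Suc A + n) * d\<bar> \<le> k - 1 + k * (k ^ A - 1)"
      using that(2) by linarith
    thus ?thesis by (simp add: algebra_simps)
  qed
  with 1 digit_diff_bound[OF assms(2)] assms(1) show False unfolding far_def by blast
qed

text \<open>Steps of digit sum zero lower the exponent until the sum is
  \<open>k (k^(n+1) - 1)\<close>. One step of digit sum \<open>-k\<close> turns this into
  \<open>k^(n+1)\<close>, and \<open>far\<close> has by then become the divisibility condition of
  \<open>expansion_diff_sum_power\<close>.\<close>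

lemma expansion_diff_power_diff_aux:
  assumes "x + y + z = k ^ Suc A * (k ^ Suc n - 1)" "minus_ok x y z" "far (Suc A) n x y z"
  shows "expansion_diff x y z"
  using assms
proof (induction A arbitrary: x y z)
  case 0
  have "k dvd x + y + z" using 0(1) by simp
  then obtain x1 y1 z1 where 1: "digit_diff (x - k * x1) (y - k * y1) (z - k * z1)"
    "k * (x1 + y1 + z1) = x + y + z + k"
    using 0(2) unfolding minus_ok_def by (metis step_minus)
  have "k * (x1 + y1 + z1) = k * k ^ Suc n" using 0(1) 1(2) by (simp add: algebra_simps)
  hence s: "x1 + y1 + z1 = k ^ Suc n" using k_ge by simp
  have "far 0 n x1 y1 z1" using far_step[OF 0(3) 1(1)] .
  hence "\<not> (k ^ n dvd x1 \<and> k ^ n dvd y1 \<and> k ^ n dvd z1)"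
    unfolding far_def by (auto simp: dvd_def)
  from expansion_diff_step[OF 1(1) expansion_diff_sum_power[OF s this]] show ?case .
next
  case (Suc A)
  have "k dvd x + y + z" using Suc.prems(1) by simp
  then obtain x1 y1 z1 where 1: "digit_diff (x - k * x1) (y - k * y1) (z - k * z1)"
    "k * (x1 + y1 + z1) = x + y + z" "\<not> aligned x1 y1 z1"
    using Suc.prems(2) unfolding minus_ok_def by (metis step_zero)
  have "k * (x1 + y1 + z1) = k * (k ^ Suc A * (k ^ Suc n - 1))"
    using Suc.prems(1) 1(2) by (simp add: algebra_simps)
  hence "x1 + y1 + z1 = k ^ Suc A * (k ^ Suc n - 1)" using k_ge by simp
  from expansion_diff_step[OF 1(1) Suc.IH[OF this not_aligned_ok(3)[OF 1(3)] far_step[OF Suc.prems(3) 1(1)]]]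
  show ?case .
qed

text \<open>For \<open>A > 0\<close> there is room for an initial step of digit sum zero with
  non-aligned quotient, so exceptional residues can obstruct only when \<open>A = 0\<close>.\<close>

lemma expansion_diff_power_diff:
  assumes "x + y + z = k ^ Suc A * (k ^ Suc n - 1)" "\<not> (k dvd x \<and> k dvd y \<and> k dvd z)"
    "A = 0 \<Longrightarrow> minus_ok x y z" "far (Suc A) n x y z"
  shows "expansion_diff x y z"
proof (cases A)
  case 0
  thus ?thesis using expansion_diff_power_diff_aux assms by blast
next
  case (Suc B)
  have "k dvd x + y + z" using assms(1) by simp
  with assms(2) obtain x1 y1 z1 where 1: "digit_diff (x - k * x1) (y - k * y1) (z - k * z1)"
    "k * (x1 + y1 + z1) = x + y + z" "\<not> aligned x1 y1 z1"
    by (metis step_zero)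
  have "k * (x1 + y1 + z1) = k * (k ^ Suc B * (k ^ Suc n - 1))"
    using assms(1) Suc 1(2) by (simp add: algebra_simps)
  hence "x1 + y1 + z1 = k ^ Suc B * (k ^ Suc n - 1)" using k_ge by simp
  from expansion_diff_step[OF 1(1) expansion_diff_power_diff_aux[OF this not_aligned_ok(3)[OF 1(3)]
      far_step[OF assms(4)[unfolded Suc] 1(1)]]]
  show ?thesis .
qed

section \<open>Rational directions\<close>

text \<open>If \<open>x\<close> were close both to \<open>k^(A+1) (k^(n+1) - 1) \<beta>\<close> and
  to \<open>k^(A+1+n) a\<close>, then \<open>k \<beta>\<close> would lie within
  \<open>(1 + |\<beta>|) / k^n\<close> of the integer \<open>a\<close>. The estimate is uniform in
  \<open>A\<close>.\<close>

lemma far_from_lattice: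
  fixes \<beta> :: real
  assumes "of_int k * \<beta> \<notin> \<int>"
  obtains n0 where "\<And>n A x a. n0 \<le> n \<Longrightarrow>
    \<bar>of_int x - of_int (k ^ Suc A * (k ^ Suc n - 1)) * \<beta>\<bar> \<le> 1 \<Longrightarrow>
    \<not> \<bar>x - k ^ (Suc A + n) * a\<bar> \<le> k ^ Suc A - 1"
proof -
  define \<kappa> where "\<kappa> = real_of_int k"
  define \<eta> where "\<eta> = \<bar>\<kappa> * \<beta> - of_int (round (\<kappa> * \<beta>))\<bar>"
  have k1: "1 < \<kappa>" using k_ge unfolding \<kappa>_def by simp
  have \<eta>: "\<eta> > 0" using assms unfolding \<eta>_def \<kappa>_def by (metis Ints_of_int eq_iff_diff_eq_0 zero_less_abs_iff)
  obtain n0 where n0: "(1 + \<bar>\<beta>\<bar>) / \<eta> < \<kappa> ^ n0" using real_arch_pow[OF k1] by blast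
  have "\<not> \<bar>x - k ^ (Suc A + n) * a\<bar> \<le> k ^ Suc A - 1"
    if n: "n0 \<le> n" and x: "\<bar>of_int x - of_int (k ^ Suc A * (k ^ Suc n - 1)) * \<beta>\<bar> \<le> 1" for n A x a
  proof
    assume "\<bar>x - k ^ (Suc A + n) * a\<bar> \<le> k ^ Suc A - 1"
    hence "real_of_int \<bar>x - k ^ (Suc A + n) * a\<bar> \<le> of_int (k ^ Suc A - 1)" by linarith
    hence 1: "\<bar>real_of_int x - \<kappa> ^ (Suc A + n) * of_int a\<bar> \<le> \<kappa> ^ Suc A - 1"
      unfolding \<kappa>_def by simp
    have 2: "\<bar>real_of_int x - \<kappa> ^ Suc A * (\<kappa> ^ Suc n - 1) * \<beta>\<bar> \<le> 1"
      using x unfolding \<kappa>_def by simp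
    have "\<kappa> ^ (Suc A + n) * (\<kappa> * \<beta> - of_int a) =
      (real_of_int x - \<kappa> ^ (Suc A + n) * of_int a) - (real_of_int x - \<kappa> ^ Suc A * (\<kappa> ^ Suc n - 1) * \<beta>)
      + \<kappa> ^ Suc A * \<beta>" by (simp add: algebra_simps power_add)
    moreover have "\<bar>\<kappa> ^ Suc A * \<beta>\<bar> = \<kappa> ^ Suc A * \<bar>\<beta>\<bar>" using k1 by (simp add: abs_mult)
    ultimately have "\<bar>\<kappa> ^ (Suc A + n) * (\<kappa> * \<beta> - of_int a)\<bar> \<le> \<kappa> ^ Suc A + \<kappa> ^ Suc A * \<bar>\<beta>\<bar>"
      using 1 2 by linarith
    moreover have "\<bar>\<kappa> ^ (Suc A + n) * (\<kappa> * \<beta> - of_int a)\<bar> =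
        \<kappa> ^ Suc A * (\<kappa> ^ n * \<bar>\<kappa> * \<beta> - of_int a\<bar>)"
      unfolding abs_mult power_add using k1 by simp
    ultimately have "\<kappa> ^ Suc A * (\<kappa> ^ n * \<bar>\<kappa> * \<beta> - of_int a\<bar>) \<le> \<kappa> ^ Suc A * (1 + \<bar>\<beta>\<bar>)"
      by (simp add: distrib_left)
    hence "\<kappa> ^ n * \<bar>\<kappa> * \<beta> - of_int a\<bar> \<le> 1 + \<bar>\<beta>\<bar>" using k1 by simp
    moreover have "\<eta> \<le> \<bar>\<kappa> * \<beta> - of_int a\<bar>" unfolding \<eta>_def
      by (metis abs_minus_commute round_diff_minimal)
    hence "\<kappa> ^ n * \<eta> \<le> \<kappa> ^ n * \<bar>\<kappa> * \<beta> - of_int a\<bar>" using k1 by (intro mult_left_mono) auto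
    moreover have "\<kappa> ^ n0 * \<eta> \<le> \<kappa> ^ n * \<eta>" using n k1 \<eta> by (intro mult_right_mono power_increasing) auto
    ultimately have "\<kappa> ^ n0 * \<eta> \<le> 1 + \<bar>\<beta>\<bar>" by linarith
    thus False using n0 \<eta> by (simp add: field_simps)
  qed
  thus thesis using that by blast
qed

lemma coprime_vector_dvd:
  assumes "coprime_vector a b c" "d dvd m * a" "d dvd m * b" "d dvd m * c"
  shows "d dvd m"
proof -
  have "d dvd gcd (m * a) (gcd (m * b) (m * c))" using assms by simp
  also have "gcd (m * a) (gcd (m * b) (m * c)) = \<bar>m\<bar> * gcd a (gcd b c)"
    by (metis abs_mult_self_eq gcd_mult_distrib_int gcd_abs1_int gcd_abs2_int abs_mult abs_abs)
  finally show ?thesis using assms(1) unfolding coprime_vector_def by simp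
qed

text \<open>The powers of \<open>k\<close> take finitely many values modulo \<open>s\<close>;
  \<open>A\<close> accounts for the preperiod caused by common factors of \<open>k\<close> and
  \<open>s\<close>.\<close>

lemma eventually_periodic_power:
  fixes s :: int
  assumes "s \<noteq> 0"
  obtains A n where "s dvd k ^ A * (k ^ Suc n - 1)"
proof -
  have "finite (range (\<lambda>i. k ^ i mod s))"
  proof (rule finite_subset)
    show "range (\<lambda>i. k ^ i mod s) \<subseteq> {- \<bar>s\<bar>..\<bar>s\<bar>}"
    proof safe
      fix i
      have "\<bar>k ^ i mod s\<bar> < \<bar>s\<bar>" using abs_mod_less[OF assms] .
      thus "k ^ i mod s \<in> {- \<bar>s\<bar>..\<bar>s\<bar>}" by auto
    qed
  qed simp
  hence "\<not> inj (\<lambda>i::nat. k ^ i mod s)" using finite_imageD infinite_UNIV_nat by blast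
  then obtain i' j' :: nat where ij': "k ^ i' mod s = k ^ j' mod s" "i' \<noteq> j'" unfolding inj_def by blast
  obtain i j :: nat where "k ^ j mod s = k ^ i mod s" "i < j"
    using ij' that[of j' i'] that[of i' j'] by (cases "i' < j'") auto
  hence "s dvd k ^ j - k ^ i" by (simp only: mod_eq_dvd_iff)
  moreover have "k ^ j - k ^ i = k ^ i * (k ^ Suc (j - i - 1) - 1)"
    using \<open>i < j\<close> by (simp add: right_diff_distrib flip: power_add power_Suc)
  ultimately show thesis using that by metis
qed

definition exceptional :: "int \<Rightarrow> int \<Rightarrow> int \<Rightarrow> bool" where
  "exceptional a b c \<longleftrightarrow> 3 dvd a + b + c \<and> [a = b] (mod 3) \<and>
     [b = - ((a + b + c) div 3)] (mod 3) \<and> \<not> [- ((a + b + c) div 3) = 0] (mod 3)"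

text \<open>Modulo 3 the factor \<open>m\<close> is invertible, so
  \<open>t = 2 d = -d\<close>.\<close>

lemma mod_3_quotient:
  fixes m d t :: int
  assumes "m * d mod 3 = 1" "m * t mod 3 = 2"
  shows "d mod 3 = (- t) mod 3" "(- t) mod 3 \<noteq> 0"
proof -
  have 1: "(m mod 3) * (d mod 3) mod 3 = 1" "(m mod 3) * (t mod 3) mod 3 = 2"
    using assms by (simp_all add: mod_mult_eq)
  have "m mod 3 = 0 \<or> m mod 3 = 1 \<or> m mod 3 = 2" "d mod 3 = 0 \<or> d mod 3 = 1 \<or> d mod 3 = 2"
    "t mod 3 = 0 \<or> t mod 3 = 1 \<or> t mod 3 = 2" by presburger+
  hence "d mod 3 = 1 \<and> t mod 3 = 2 \<or> d mod 3 = 2 \<and> t mod 3 = 1" using 1 by auto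
  thus "d mod 3 = (- t) mod 3" "(- t) mod 3 \<noteq> 0" by presburger+
qed

text \<open>With \<open>s = a + b + c\<close>, a factor \<open>m\<close> not divisible by
  \<open>k\<close> is chosen so that the coordinate sum \<open>m s\<close> is \<open>0\<close>,
  \<open>k\<close> or \<open>k^A (k^(n+1) - 1)\<close>, the sums for which membership in
  \<open>E\<close> is known.\<close>

lemma rational_collision:
  assumes cop: "coprime_vector a b c" and nc: "\<not> coprime (a + b + c) k"
    and ne: "k = 3 \<Longrightarrow> l = 1 \<Longrightarrow> \<not> exceptional a b c"
  shows "\<exists>m. m \<noteq> 0 \<and> expansion_diff (m * a) (m * b) (m * c)"
proof -
  define s where "s = a + b + c"
  have nz: "\<not> (k dvd m * a \<and> k dvd m * b \<and> k dvd m * c)" if "\<not> k dvd m" for m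
    using coprime_vector_dvd[OF cop] that by blast
  have sum: "m * a + m * b + m * c = m * s" for m unfolding s_def by (simp add: algebra_simps)
  consider "s = 0" | "s \<noteq> 0" "s dvd k" | "s \<noteq> 0" "\<not> s dvd k" by blast
  thus ?thesis
  proof cases
    case 1
    hence "expansion_diff (1 * a) (1 * b) (1 * c)" unfolding s_def by (simp add: expansion_diff_sum_zero)
    thus ?thesis by (intro exI[of _ 1]) simp
  next
    case 2
    then obtain m where m: "m * s = k" by (metis dvdE mult.commute)
    have m0: "m \<noteq> 0" using m k_ge by auto
    have km: "\<not> k dvd m"
    proof
      assume "k dvd m"
      then obtain j where "m = k * j" by blast
      hence "k * (j * s) = k * 1" using m by (metis mult.assoc mult.right_neutral)
      hence "s dvd 1" using k_ge by (metis dvd_triv_right mult_cancel_left not_numeral_le_zero)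
      thus False using nc unfolding s_def by (simp add: is_unit_left_imp_coprime)
    qed
    have "plus_ok (m * a) (m * b) (m * c)"
      unfolding plus_ok_def
    proof (intro conjI notI)
      assume "k dvd m * a \<and> k dvd m * b \<and> k dvd m * c" with nz[OF km] show False by blast
    next
      \<comment> \<open>Now \<open>m s = 3\<close> and \<open>s\<close> is no unit, so
        \<open>s\<close> is \<open>3\<close> or \<open>-3\<close>; the residues of
        \<open>m a\<close> and \<open>m b\<close> then make \<open>(a, b, c)\<close>
        exceptional.\<close>
      assume h: "k = 3 \<and> l = 1 \<and> m * a mod 3 = 2 \<and> m * b mod 3 = 2 \<and> m * c mod 3 = 2"
      hence "m * s = 3" using m by simp
      have "\<bar>s\<bar> \<noteq> 1" using nc unfolding s_def by (metis abs_1 coprime_abs_left_iff coprime_1_left)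
      have "\<bar>m\<bar> * \<bar>s\<bar> = 3" using \<open>m * s = 3\<close> by (metis abs_mult abs_numeral)
      hence "\<bar>s\<bar> dvd 3" by (metis dvd_triv_right)
      moreover have "prime (3::int)" by simp
      ultimately have "\<bar>s\<bar> = 3" using \<open>\<bar>s\<bar> \<noteq> 1\<close> unfolding prime_int_iff by (metis abs_ge_zero)
      moreover have "m = 1" if "s = 3" using \<open>m * s = 3\<close> that by simp
      moreover have "m = -1" if "s = -3" using \<open>m * s = 3\<close> that by simp
      ultimately have "s = 3 \<and> m = 1 \<or> s = -3 \<and> m = -1" by linarith
      hence "exceptional a b c"
      proof
        assume "s = 3 \<and> m = 1"
        thus ?thesis using h unfolding exceptional_def s_def cong_def by simp
      next
        assume sm: "s = -3 \<and> m = -1"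
        hence "a mod 3 = 1" "b mod 3 = 1" using h by presburger+
        thus ?thesis using sm unfolding exceptional_def s_def cong_def by simp
      qed
      with ne h show False by blast
    qed
    with m have "expansion_diff (m * a) (m * b) (m * c)"
      by (intro expansion_diff_sum_k) (simp_all add: sum)
    thus ?thesis using m0 by blast
  next
    case 3
    \<comment> \<open>As \<open>s\<close> does not divide \<open>k\<close> and
      \<open>(a, b, c)\<close> is primitive, some coordinate satisfies the hypothesis of
      \<open>far_from_lattice\<close>.\<close>
    have "\<exists>d \<in> {a, b, c}. of_int k * (of_int d / of_int s :: real) \<notin> \<int>"
    proof (rule ccontr)
      assume "\<not> ?thesis"
      hence i: "\<forall>d\<in>{a, b, c}. of_int k * (of_int d / of_int s :: real) \<in> \<int>" by blast
      have "s dvd k * d" if d: "d \<in> {a, b, c}" for d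
      proof -
        obtain j where "of_int k * (of_int d / of_int s :: real) = of_int j" using bspec[OF i d] by (elim Ints_cases)
        hence "real_of_int (k * d) = of_int (s * j)" using 3(1) by (simp add: field_simps)
        hence "k * d = s * j" by (simp only: of_int_eq_iff)
        thus ?thesis by simp
      qed
      hence "s dvd k" using coprime_vector_dvd[OF cop] by blast
      thus False using 3 by blast
    qed
    then obtain d where d: "d \<in> {a, b, c}" "of_int k * (of_int d / of_int s :: real) \<notin> \<int>" by blast
    obtain n0 where n0: "\<And>n A x e. n0 \<le> n \<Longrightarrow>
      \<bar>of_int x - of_int (k ^ Suc A * (k ^ Suc n - 1)) * (of_int d / of_int s :: real)\<bar> \<le> 1 \<Longrightarrow>
      \<not> \<bar>x - k ^ (Suc A + n) * e\<bar> \<le> k ^ Suc A - 1"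
      using far_from_lattice[OF d(2)] by blast
    define P where "P A \<longleftrightarrow> (\<exists>n. s dvd k ^ A * (k ^ Suc n - 1))" for A
    have ex: "\<exists>A. P A" using eventually_periodic_power[OF 3(1)] unfolding P_def by metis
    \<comment> \<open>Minimality of \<open>A\<close> is what keeps \<open>k\<close> from dividing
      \<open>m\<close> below.\<close>
    define A where "A = (LEAST A. P A)"
    have PA: "P A" using LeastI_ex[OF ex] unfolding A_def .
    have "A \<noteq> 0"
    proof
      assume "A = 0"
      then obtain n where "s dvd k ^ Suc n - 1" using PA unfolding P_def by auto
      have "coprime s k"
      proof (rule coprimeI)
        fix e assume e: "e dvd s" "e dvd k"
        have "e dvd k ^ Suc n" using e(2) by simp
        moreover have "e dvd k ^ Suc n - 1" using e(1) \<open>s dvd k ^ Suc n - 1\<close> by (rule dvd_trans)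
        ultimately have "e dvd k ^ Suc n - (k ^ Suc n - 1)" by (rule dvd_diff)
        thus "is_unit e" by simp
      qed
      thus False using nc unfolding s_def by blast
    qed
    then obtain B where B: "A = Suc B" by (cases A) auto
    have nP: "\<not> P B" using not_less_Least[of B P] B unfolding A_def by simp
    obtain n1 where n1: "s dvd k ^ A * (k ^ Suc n1 - 1)" using PA unfolding P_def by blast
    \<comment> \<open>\<open>Suc n\<close> is a multiple of \<open>Suc n1\<close>, which preserves
      the divisibility by \<open>s\<close>, and \<open>n >= n0\<close>, which gives access to
      \<open>far_from_lattice\<close>.\<close>
    define n where "n = Suc n1 * Suc n0 - 1"
    have sn: "Suc n = Suc n1 * Suc n0" unfolding n_def by simp
    have nn: "n0 \<le> n" unfolding n_def by simp
    have "k ^ Suc n1 - 1 dvd (k ^ Suc n1) ^ Suc n0 - 1" by (simp only: power_diff_1_eq dvd_triv_left)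
    hence "k ^ Suc n1 - 1 dvd k ^ Suc n - 1" unfolding sn power_mult .
    hence "s dvd k ^ A * (k ^ Suc n - 1)" by (rule dvd_trans[OF n1 mult_dvd_mono[OF dvd_refl]])
    then obtain m where "k ^ A * (k ^ Suc n - 1) = s * m" by (elim dvdE)
    hence m: "m * s = k ^ A * (k ^ Suc n - 1)" by (simp only: mult.commute)
    have kn: "k ^ Suc n > 1" using k_ge by (intro one_less_power) auto
    have "m * s \<noteq> 0" unfolding m using kn k_ge by simp
    hence m0: "m \<noteq> 0" by auto
    have km: "\<not> k dvd m"
    proof
      assume "k dvd m"
      then obtain j where "m = k * j" by blast
      hence "k * (j * s) = k * (k ^ B * (k ^ Suc n - 1))" using m B by (simp add: mult.assoc)
      hence "j * s = k ^ B * (k ^ Suc n - 1)" using k_ge by simp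
      hence "P B" unfolding P_def by (metis dvd_triv_right)
      thus False using nP by blast
    qed
    have "expansion_diff (m * a) (m * b) (m * c)"
    proof (rule expansion_diff_power_diff)
      show "m * a + m * b + m * c = k ^ Suc B * (k ^ Suc n - 1)" using m B by (simp add: sum)
      show "\<not> (k dvd m * a \<and> k dvd m * b \<and> k dvd m * c)" using nz[OF km] .
      show "minus_ok (m * a) (m * b) (m * c)" if "B = 0"
        unfolding minus_ok_def
      proof (intro conjI notI)
        assume "k dvd m * a \<and> k dvd m * b \<and> k dvd m * c" with nz[OF km] show False by blast
      next
        assume h: "k = 3 \<and> l = 1 \<and> m * a mod 3 = 1 \<and> m * b mod 3 = 1 \<and> m * c mod 3 = 1"
        have "3 dvd s"
        proof (rule ccontr)
          assume "\<not> 3 dvd s"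
          hence "coprime 3 s" by (simp add: prime_imp_coprime)
          thus False using nc h unfolding s_def by (simp add: coprime_commute)
        qed
        then obtain t where t: "s = 3 * t" by blast
        \<comment> \<open>Cancelling 3 leaves \<open>m t = 3^(n+1) - 1\<close>, which is 2 modulo 3,
          while \<open>m a\<close> and \<open>m b\<close> are 1 modulo 3; this makes
          \<open>(a, b, c)\<close> exceptional.\<close>
        have "3 * (m * t) = 3 * (3 ^ Suc n - 1)" using m h t that B by simp
        hence "m * t = 2 + 3 * (3 ^ n - 1)" by simp
        hence mt: "m * t mod 3 = 2" by (simp only: mod_mult_self2) simp
        have "m * a mod 3 = 1" "m * b mod 3 = 1" using h by blast+
        note mod_3_quotient[OF this(1) mt] mod_3_quotient[OF this(2) mt]
        hence "exceptional a b c" using t unfolding exceptional_def cong_def s_def[symmetric] by simp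
        with ne h show False by blast
      qed
      have "of_int (k ^ Suc B * (k ^ Suc n - 1)) * (of_int d / of_int s :: real) =
          of_int (m * s) * (of_int d / of_int s)" using m B by simp
      also have "\<dots> = of_int (m * d)" using 3(1) by simp
      finally have "of_int (m * d) - of_int (k ^ Suc B * (k ^ Suc n - 1)) * (of_int d / of_int s :: real) = 0"
        by simp
      hence "\<not> \<bar>m * d - k ^ (Suc B + n) * e\<bar> \<le> k ^ Suc B - 1" for e
        using n0[OF nn, of "m * d" B] by simp
      thus "far (Suc B) n (m * a) (m * b) (m * c)" using d(1) unfolding far_def by blast
    qed
    thus ?thesis using m0 by blast
  qed
qed

section \<open>Absence of collisions in admissible directions\<close>

lemma digits_cong_eq:
  assumes "(p, q, r) \<in> digits" "(p', q', r') \<in> digits" "k dvd p - p'" "k dvd q - q'" "k dvd r - r'"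
  shows "p = p'" "q = q'" "r = r'"
proof -
  have "x = y" if "k dvd x - y" "0 \<le> x" "x \<le> k - 1" "0 \<le> y" "y \<le> k - 1" for x y
    using that by (smt (verit) mod_eq_dvd_iff mod_pos_pos_trivial)
  thus "p = p'" "q = q'" "r = r'" using assms unfolding digits_def by auto
qed

text \<open>A digit triple with sum divisible by 3 is constant or a permutation of
  \<open>0, 1, 2\<close>. If 3 did not divide \<open>M\<close>, the prescribed differences modulo 3
  would make the total difference \<open>-3 M\<close> or \<open>0\<close> modulo 9, never
  \<open>3 M\<close>.\<close>

lemma mod_9_obstruction:
  fixes M :: int
  assumes s: "d1 - e1 + (d2 - e2) + (d3 - e3) = 3 * M + 9 * q"
    and dm: "(d1 - e1) mod 3 = (- M) mod 3" "(d2 - e2) mod 3 = (- M) mod 3" "(d3 - e3) mod 3 = (- M) mod 3"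
    and dd: "d1 \<in> {0, 1, 2}" "d2 \<in> {0, 1, 2}" "d3 \<in> {0, 1, 2}"
      "e1 \<in> {0, 1, 2}" "e2 \<in> {0, 1, 2}" "e3 \<in> {0, 1, 2}"
      "3 dvd d1 + d2 + d3" "3 dvd e1 + e2 + e3"
  shows "M mod 3 = 0"
proof (rule ccontr)
  assume "M mod 3 \<noteq> 0"
  hence "M mod 3 = 1 \<or> M mod 3 = 2" by presburger
  then consider "M mod 3 = 1" | "M mod 3 = 2" by blast
  thus False
  proof cases
    case 1
    define N where "N = M div 3"
    have M: "M = 3 * N + 1" using 1 unfolding N_def by presburger
    have "(- M) mod 3 = 2" using 1 by presburger
    hence "e = 0 \<and> d = 2 \<or> e = 1 \<and> d = 0 \<or> e = 2 \<and> d = 1"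
      if "(d - e) mod 3 = (- M) mod 3" "d \<in> {0, 1, 2}" "e \<in> {0, 1, 2}" for d e
      using that by auto
    note c = this[OF dm(1) dd(1,4)] this[OF dm(2) dd(2,5)] this[OF dm(3) dd(3,6)]
    have "d1 - e1 + (d2 - e2) + (d3 - e3) = 9 * (N + q) + 3" using s M by simp
    hence "(d1 - e1 + (d2 - e2) + (d3 - e3)) mod 9 = (9 * (N + q) + 3) mod 9" by (rule arg_cong)
    also have "\<dots> = 3" by (subst mod_mult_self4) simp
    finally have "(d1 - e1 + (d2 - e2) + (d3 - e3)) mod 9 = 3" .
    thus False using c dd(7,8) by (elim disjE conjE) simp_all
  next
    case 2
    define N where "N = M div 3"
    have M: "M = 3 * N + 2" using 2 unfolding N_def by presburger
    have "(- M) mod 3 = 1" using 2 by presburger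
    hence "e = 0 \<and> d = 1 \<or> e = 1 \<and> d = 2 \<or> e = 2 \<and> d = 0"
      if "(d - e) mod 3 = (- M) mod 3" "d \<in> {0, 1, 2}" "e \<in> {0, 1, 2}" for d e
      using that by auto
    note c = this[OF dm(1) dd(1,4)] this[OF dm(2) dd(2,5)] this[OF dm(3) dd(3,6)]
    have "d1 - e1 + (d2 - e2) + (d3 - e3) = 9 * (N + q) + 6" using s M by simp
    hence "(d1 - e1 + (d2 - e2) + (d3 - e3)) mod 9 = (9 * (N + q) + 6) mod 9" by (rule arg_cong)
    also have "\<dots> = 6" by (subst mod_mult_self4) simp
    finally have "(d1 - e1 + (d2 - e2) + (d3 - e3)) mod 9 = 6" .
    thus False using c dd(7,8) by (elim disjE conjE) simp_all
  qed
qed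

text \<open>Descent on the number of digits: the lowest digits force \<open>k\<close> to divide
  \<open>m\<close>, hence they agree and can be cancelled, and \<open>m\<close> is divided by
  \<open>k\<close>.\<close>

lemma expansions_no_collision:
  assumes cop: "coprime_vector a b c"
    and ok: "coprime (a + b + c) k \<or> k = 3 \<and> l = 1 \<and> exceptional a b c"
    and "(p, q, r) \<in> expansions n" "(p', q', r') \<in> expansions n"
    and "p - p' = m * a" "q - q' = m * b" "r - r' = m * c"
  shows "p = p' \<and> q = q' \<and> r = r'"
  using assms(3-)
proof (induction n arbitrary: p q r p' q' r' m)
  case 0
  thus ?case by simp
next
  case (Suc n)
  obtain d1 d2 d3 u1 u2 u3 where d: "(d1, d2, d3) \<in> digits" "(u1, u2, u3) \<in> expansions n"
    "p = d1 + k * u1" "q = d2 + k * u2" "r = d3 + k * u3" using Suc.prems(1) by auto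
  obtain d1' d2' d3' u1' u2' u3' where d': "(d1', d2', d3') \<in> digits" "(u1', u2', u3') \<in> expansions n"
    "p' = d1' + k * u1'" "q' = d2' + k * u2'" "r' = d3' + k * u3'" using Suc.prems(2) by auto
  have e: "d1 - d1' = m * a + k * (u1' - u1)" "d2 - d2' = m * b + k * (u2' - u2)"
    "d3 - d3' = m * c + k * (u3' - u3)"
    using d d' Suc.prems by (simp_all add: algebra_simps)
  have "k dvd m"
    using ok
  proof
    assume "coprime (a + b + c) k"
    have "k dvd d1 + d2 + d3 - (l - 1)" "k dvd d1' + d2' + d3' - (l - 1)"
      using d(1) d'(1) unfolding digits_def by auto
    hence "k dvd (d1 + d2 + d3 - (l - 1)) - (d1' + d2' + d3' - (l - 1))" by (rule dvd_diff)
    also have "\<dots> = m * (a + b + c) + k * (u1' - u1 + (u2' - u2) + (u3' - u3))"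
      using e by (simp add: algebra_simps)
    finally have "k dvd m * (a + b + c)" by (simp add: dvd_add_left_iff)
    thus ?thesis using \<open>coprime (a + b + c) k\<close> by (simp add: coprime_commute coprime_dvd_mult_left_iff)
  next
    assume h: "k = 3 \<and> l = 1 \<and> exceptional a b c"
    \<comment> \<open>As \<open>l - 1 = 0\<close>, the coordinate sum of every expansion is a
      multiple of 3. So the carries contribute multiples of 9 to the digit sum, which can therefore
      be read modulo 9.\<close>
    have three: "3 dvd x + y + z" if "(x, y, z) \<in> expansions n" for x y z n
      using that
    proof (induction n arbitrary: x y z)
      case (Suc n)
      then obtain e1 e2 e3 v1 v2 v3 where "(e1, e2, e3) \<in> digits" "(v1, v2, v3) \<in> expansions n"
        "x = e1 + k * v1" "y = e2 + k * v2" "z = e3 + k * v3" by auto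
      thus ?case using h unfolding digits_def by simp presburger
    qed simp
    obtain t where t: "a + b + c = 3 * t" using h unfolding exceptional_def by blast
    obtain i where i: "u1 + u2 + u3 = 3 * i" using three[OF d(2)] by blast
    obtain i' where i': "u1' + u2' + u3' = 3 * i'" using three[OF d'(2)] by blast
    have at: "a mod 3 = (- t) mod 3" "b mod 3 = (- t) mod 3" "t mod 3 \<noteq> 0"
      using h t unfolding exceptional_def cong_def by auto
    have "3 dvd a + t" "3 dvd b + t" using at(1,2) by (simp_all add: mod_eq_dvd_iff)
    hence "3 dvd 3 * (2 * t) - (a + t) - (b + t)" by (intro dvd_diff dvd_triv_left)
    also have "3 * (2 * t) - (a + t) - (b + t) = c - (- t)" using t by simp
    finally have ct: "c mod 3 = (- t) mod 3" by (simp only: mod_eq_dvd_iff)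
    define M where "M = m * t"
    have ma: "m * a mod 3 = (- M) mod 3" "m * b mod 3 = (- M) mod 3" "m * c mod 3 = (- M) mod 3"
      unfolding M_def mult_minus_right[symmetric] using at ct by (metis mod_mult_right_eq)+
    have "m * a + m * b + m * c = 3 * M" unfolding M_def using t by (simp flip: distrib_left)
    hence s: "d1 - d1' + (d2 - d2') + (d3 - d3') = 3 * M + 9 * (i' - i)"
      using e i i' h by simp
    have dm: "(d1 - d1') mod 3 = (- M) mod 3" "(d2 - d2') mod 3 = (- M) mod 3" "(d3 - d3') mod 3 = (- M) mod 3"
      using e ma h mod_mult_self2 by metis+
    have dd: "d1 \<in> {0, 1, 2}" "d2 \<in> {0, 1, 2}" "d3 \<in> {0, 1, 2}"
      "d1' \<in> {0, 1, 2}" "d2' \<in> {0, 1, 2}" "d3' \<in> {0, 1, 2}"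
      "3 dvd d1 + d2 + d3" "3 dvd d1' + d2' + d3'"
      using d(1) d'(1) h unfolding digits_def by auto
    have "M mod 3 = 0" using mod_9_obstruction[OF s dm dd] .
    hence "3 dvd m * t" unfolding M_def by (simp add: dvd_eq_mod_eq_0)
    moreover have "\<not> 3 dvd t" using at(3) by presburger
    moreover have "prime (3::int)" by simp
    ultimately show ?thesis using h by (metis prime_dvd_mult_iff)
  qed
  then obtain j where j: "m = k * j" by blast
  have "k dvd d1 - d1'" "k dvd d2 - d2'" "k dvd d3 - d3'" using e j by simp_all
  note eq = digits_cong_eq[OF d(1) d'(1) this]
  have "k * (u1 - u1') = k * (j * a)" "k * (u2 - u2') = k * (j * b)" "k * (u3 - u3') = k * (j * c)"
    using e eq j by (simp_all add: algebra_simps)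
  hence "u1 - u1' = j * a" "u2 - u2' = j * b" "u3 - u3' = j * c" using k_ge by simp_all
  from Suc.IH[OF d(2) d'(2) this] eq d d' show ?case by simp
qed

section \<open>Counting digits and expansions\<close>

lemma digits_eq_image:
  "digits = (\<lambda>(x, y). (x, y, (l - 1 - x - y) mod k)) ` ({0..k - 1} \<times> {0..k - 1})"
proof (intro equalityI subsetI)
  fix w assume "w \<in> digits"
  then obtain x y z where w: "w = (x, y, z)" "x \<in> {0..k - 1}" "y \<in> {0..k - 1}" "z \<in> {0..k - 1}"
    "k dvd x + y + z - (l - 1)" unfolding digits_def by auto
  have "z mod k = (l - 1 - x - y) mod k"
    using w(5) by (simp add: mod_eq_dvd_iff algebra_simps)
  hence "z = (l - 1 - x - y) mod k" using w(4) by simp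
  thus "w \<in> (\<lambda>(x, y). (x, y, (l - 1 - x - y) mod k)) ` ({0..k - 1} \<times> {0..k - 1})"
    using w by (intro image_eqI[of _ _ "(x, y)"]) auto
next
  fix w assume "w \<in> (\<lambda>(x, y). (x, y, (l - 1 - x - y) mod k)) ` ({0..k - 1} \<times> {0..k - 1})"
  then obtain x y where w: "w = (x, y, (l - 1 - x - y) mod k)" "x \<in> {0..k - 1}" "y \<in> {0..k - 1}" by auto
  have "0 \<le> (l - 1 - x - y) mod k" "(l - 1 - x - y) mod k \<le> k - 1"
    using k_ge by (simp_all add: zle_diff1_eq)
  moreover have "x + y + (l - 1 - x - y) mod k - (l - 1) =
      - ((l - 1 - x - y) - (l - 1 - x - y) mod k)" by simp
  hence "k dvd x + y + (l - 1 - x - y) mod k - (l - 1)" by (metis dvd_minus_iff dvd_minus_mod)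
  ultimately show "w \<in> digits" using w unfolding digits_def by auto
qed

lemma finite_digits: "finite digits"
  unfolding digits_eq_image by simp

lemma digits_nonempty: "digits \<noteq> {}"
  unfolding digits_eq_image using k_ge by simp

lemma card_digits: "card digits = nat k ^ 2"
  unfolding digits_eq_image
  by (subst card_image) (auto simp: inj_on_def card_cartesian_product power2_eq_square)

lemma finite_expansions: "finite (expansions n)"
  by (induction n) (simp_all add: finite_digits)

text \<open>The lowest digit is determined modulo \<open>k\<close>, so distinct digit strings have
  distinct values. Their number \<open>k^(2 n)\<close> is the factor by which scaling by
  \<open>k^n\<close> enlarges areas in the plane.\<close>

lemma card_expansions: "card (expansions n) = (nat k ^ 2) ^ n"
proof (induction n)
  case (Suc n)
  have "inj_on (\<lambda>((x, y, z), (x', y', z')). (x + k * x', y + k * y', z + k * z'))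
      (digits \<times> expansions n)"
  proof (rule inj_onI)
    fix s t assume st: "s \<in> digits \<times> expansions n" "t \<in> digits \<times> expansions n"
      "(\<lambda>((x, y, z), (x', y', z')). (x + k * x', y + k * y', z + k * z')) s =
       (\<lambda>((x, y, z), (x', y', z')). (x + k * x', y + k * y', z + k * z')) t"
    obtain x y z x' y' z' where s: "s = ((x, y, z), (x', y', z'))" by (metis prod.exhaust)
    obtain u v w u' v' w' where t: "t = ((u, v, w), (u', v', w'))" by (metis prod.exhaust)
    have h: "(x, y, z) \<in> digits" "(u, v, w) \<in> digits"
      and e: "x + k * x' = u + k * u'" "y + k * y' = v + k * v'" "z + k * z' = w + k * w'"
      using st s t by auto
    have "x - u = k * (u' - x')" "y - v = k * (v' - y')" "z - w = k * (w' - z')"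
      using e by (simp_all add: algebra_simps)
    hence "k dvd x - u" "k dvd y - v" "k dvd z - w" by simp_all
    note digits_cong_eq[OF h this]
    with e k_ge s t show "s = t" by simp
  qed
  thus ?case using Suc by (simp add: card_image card_cartesian_product card_digits)
qed simp

section \<open>Irrational directions\<close>

lemma far_of_approximation:
  fixes \<alpha> \<beta> \<gamma> :: real
  assumes "of_int k * \<alpha> \<notin> \<int> \<or> of_int k * \<beta> \<notin> \<int> \<or> of_int k * \<gamma> \<notin> \<int>"
  obtains n0 where "\<And>n A x y z. n0 \<le> n \<Longrightarrow>
    \<bar>of_int x - of_int (k ^ Suc A * (k ^ Suc n - 1)) * \<alpha>\<bar> \<le> 1 \<Longrightarrow>
    \<bar>of_int y - of_int (k ^ Suc A * (k ^ Suc n - 1)) * \<beta>\<bar> \<le> 1 \<Longrightarrow>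
    \<bar>of_int z - of_int (k ^ Suc A * (k ^ Suc n - 1)) * \<gamma>\<bar> \<le> 1 \<Longrightarrow> far (Suc A) n x y z"
  using assms
proof (elim disjE)
  assume "of_int k * \<alpha> \<notin> \<int>"
  then obtain n0 where "\<And>n A x a. n0 \<le> n \<Longrightarrow>
    \<bar>of_int x - of_int (k ^ Suc A * (k ^ Suc n - 1)) * \<alpha>\<bar> \<le> 1 \<Longrightarrow>
    \<not> \<bar>x - k ^ (Suc A + n) * a\<bar> \<le> k ^ Suc A - 1" using far_from_lattice by blast
  thus thesis by (intro that[of n0]) (unfold far_def, blast)
next
  assume "of_int k * \<beta> \<notin> \<int>"
  then obtain n0 where "\<And>n A x a. n0 \<le> n \<Longrightarrow>
    \<bar>of_int x - of_int (k ^ Suc A * (k ^ Suc n - 1)) * \<beta>\<bar> \<le> 1 \<Longrightarrow>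
    \<not> \<bar>x - k ^ (Suc A + n) * a\<bar> \<le> k ^ Suc A - 1" using far_from_lattice by blast
  thus thesis by (intro that[of n0]) (unfold far_def, blast)
next
  assume "of_int k * \<gamma> \<notin> \<int>"
  then obtain n0 where "\<And>n A x a. n0 \<le> n \<Longrightarrow>
    \<bar>of_int x - of_int (k ^ Suc A * (k ^ Suc n - 1)) * \<gamma>\<bar> \<le> 1 \<Longrightarrow>
    \<not> \<bar>x - k ^ (Suc A + n) * a\<bar> \<le> k ^ Suc A - 1" using far_from_lattice by blast
  thus thesis by (intro that[of n0]) (unfold far_def, blast)
qed

lemma primitive_part:
  assumes "\<not> (k ^ N dvd x \<and> k ^ N dvd y \<and> k ^ N dvd z)"
  obtains B x' y' z' where "B < N" "x = k ^ B * x'" "y = k ^ B * y'" "z = k ^ B * z'"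
    "\<not> (k dvd x' \<and> k dvd y' \<and> k dvd z')"
proof -
  define P where "P n \<longleftrightarrow> \<not> (k ^ n dvd x \<and> k ^ n dvd y \<and> k ^ n dvd z)" for n
  have "\<not> P 0" "P N" using assms unfolding P_def by auto
  then obtain B where B: "B < N" "\<not> P B" "P (Suc B)" using ex_least_nat_less[of P N] by blast
  then obtain x' y' z' where e: "x = k ^ B * x'" "y = k ^ B * y'" "z = k ^ B * z'"
    unfolding P_def by (auto elim!: dvdE)
  have "\<not> (k dvd x' \<and> k dvd y' \<and> k dvd z')"
    using B(3) k_ge unfolding P_def e by (simp add: mult.commute[of k])
  with that[OF B(1) e] show thesis .
qed

text \<open>A lower bound, in the l1 norm, for the distance of the nonzero elements of
  \<open>E\<close> from the line through \<open>(\<alpha>, \<beta>, \<gamma>)\<close>;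
  \<open>r\<close> runs over the points of that line.\<close>

definition separated :: "real \<Rightarrow> real \<Rightarrow> real \<Rightarrow> real \<Rightarrow> bool" where
  "separated \<delta> \<alpha> \<beta> \<gamma> \<longleftrightarrow> (\<forall>x y z r. expansion_diff x y z \<longrightarrow> (x, y, z) \<noteq> (0, 0, 0) \<longrightarrow>
     \<delta> \<le> \<bar>of_int x - r * \<alpha>\<bar> + \<bar>of_int y - r * \<beta>\<bar> + \<bar>of_int z - r * \<gamma>\<bar>)"

text \<open>An integer vector at l1 distance less than 1 from this line has coordinate sum zero,
  hence lies in \<open>E\<close>; the pigeonhole principle supplies nonzero ones arbitrarily
  close.\<close>

lemma not_separated_sum_zero:
  assumes \<delta>: "0 < \<delta>" and sum: "\<alpha> + \<beta> + \<gamma> = 0" and nz: "\<alpha> \<noteq> 0 \<or> \<beta> \<noteq> 0 \<or> \<gamma> \<noteq> 0"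
  shows "\<not> separated \<delta> \<alpha> \<beta> \<gamma>"
proof
  assume sep: "separated \<delta> \<alpha> \<beta> \<gamma>"
  define \<theta> where "\<theta> = \<bar>\<alpha>\<bar> + \<bar>\<beta>\<bar> + \<bar>\<gamma>\<bar>"
  have \<theta>: "\<theta> > 0" using nz unfolding \<theta>_def by auto
  define M where "M = nat \<lceil>3 / \<delta>\<rceil> + 4"
  have M: "real M > 3 / \<delta>" "real M \<ge> 4" unfolding M_def by linarith+
  hence M': "3 / real M < \<delta>" "3 / real M < 1" using \<delta> by (simp_all add: field_simps)
  \<comment> \<open>The points \<open>i c (\<alpha>, \<beta>, \<gamma>)\<close> have mutual l1
    distance at least 3, so the integer vector approximating a difference of two of them is not
    zero.\<close>
  define c where "c = 3 / \<theta>"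
  obtain i j :: nat and u v w where ij: "i < j" and
    a: "\<bar>real j * c * \<alpha> - real i * c * \<alpha> - of_int u\<bar> < 1 / M"
       "\<bar>real j * c * \<beta> - real i * c * \<beta> - of_int v\<bar> < 1 / M"
       "\<bar>real j * c * \<gamma> - real i * c * \<gamma> - of_int w\<bar> < 1 / M"
    using simultaneous_pigeonhole[of M "\<lambda>i. real i * c * \<alpha>" "\<lambda>i. real i * c * \<beta>" "\<lambda>i. real i * c * \<gamma>"] M(2)
    by (metis gr0I of_nat_0 not_numeral_le_zero)
  define r where "r = (real j - real i) * c"
  have b: "\<bar>of_int u - r * \<alpha>\<bar> < 1 / M" "\<bar>of_int v - r * \<beta>\<bar> < 1 / M" "\<bar>of_int w - r * \<gamma>\<bar> < 1 / M"
    using a unfolding r_def by (simp_all add: left_diff_distrib abs_minus_commute algebra_simps)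
  have "r * \<alpha> + r * \<beta> + r * \<gamma> = 0" using sum by (simp flip: distrib_left)
  hence "\<bar>real_of_int (u + v + w)\<bar> < 1" using b M'(2) by simp
  hence "u + v + w = 0" by linarith
  hence E: "expansion_diff u v w" by (rule expansion_diff_sum_zero)
  have "(u, v, w) \<noteq> (0, 0, 0)"
  proof
    assume "(u, v, w) = (0, 0, 0)"
    hence "\<bar>r * \<alpha>\<bar> + \<bar>r * \<beta>\<bar> + \<bar>r * \<gamma>\<bar> < 1" using b M'(2) by simp
    moreover have "\<bar>r * \<alpha>\<bar> + \<bar>r * \<beta>\<bar> + \<bar>r * \<gamma>\<bar> = \<bar>r\<bar> * \<theta>"
      unfolding \<theta>_def abs_mult by (simp add: algebra_simps)
    moreover have "\<bar>r\<bar> * \<theta> = (real j - real i) * 3"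
      unfolding r_def c_def using ij \<theta> by (simp add: abs_mult)
    ultimately have "(real j - real i) * 3 < 1" by metis
    have "1 * 3 \<le> (real j - real i) * 3" using ij by (intro mult_right_mono) auto
    also have "\<dots> < 1" by fact
    finally show False by simp
  qed
  with sep E have "\<delta> \<le> \<bar>of_int u - r * \<alpha>\<bar> + \<bar>of_int v - r * \<beta>\<bar> + \<bar>of_int w - r * \<gamma>\<bar>"
    unfolding separated_def by blast
  thus False using b M'(1) by linarith
qed

text \<open>In the irrational case the pigeonhole principle is applied to the points
  \<open>k^(J+1+i Q) (\<alpha>, \<beta>, \<gamma>)\<close>. It yields integer vectors of coordinate
  sum \<open>k^(N+1) (k^(n+1) - 1)\<close>; freed of common factors \<open>k\<close>, they lie in
  \<open>E\<close> and too close to the line.\<close>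

lemma separated_imp_rational:
  fixes \<alpha> \<beta> \<gamma> :: real
  assumes \<delta>: "0 < \<delta>" and sum: "\<alpha> + \<beta> + \<gamma> = 1" and sep: "separated \<delta> \<alpha> \<beta> \<gamma>"
  shows "\<exists>s::int. s \<noteq> 0 \<and> of_int s * \<alpha> \<in> \<int> \<and> of_int s * \<beta> \<in> \<int> \<and> of_int s * \<gamma> \<in> \<int>"
proof (rule ccontr)
  assume irr: "\<not> ?thesis"
  define \<kappa> where "\<kappa> = real_of_int k"
  have \<kappa>: "1 < \<kappa>" using k_ge unfolding \<kappa>_def by simp
  have irrk: "of_int k * \<alpha> \<notin> \<int> \<or> of_int k * \<beta> \<notin> \<int> \<or> of_int k * \<gamma> \<notin> \<int>" using irr k_ge by auto
  obtain n0 where n0: "\<And>n A x y z. n0 \<le> n \<Longrightarrow>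
    \<bar>of_int x - of_int (k ^ Suc A * (k ^ Suc n - 1)) * \<alpha>\<bar> \<le> 1 \<Longrightarrow>
    \<bar>of_int y - of_int (k ^ Suc A * (k ^ Suc n - 1)) * \<beta>\<bar> \<le> 1 \<Longrightarrow>
    \<bar>of_int z - of_int (k ^ Suc A * (k ^ Suc n - 1)) * \<gamma>\<bar> \<le> 1 \<Longrightarrow> far (Suc A) n x y z"
    using far_of_approximation[OF irrk] by metis
  define M where "M = nat \<lceil>3 / \<delta>\<rceil> + 4"
  have M: "real M > 3 / \<delta>" "real M \<ge> 4" unfolding M_def by linarith+
  hence M': "3 / real M < \<delta>" "3 / real M < 1" "1 / real M \<le> 1" using \<delta> by (simp_all add: field_simps)
  \<comment> \<open>The spacing \<open>Q\<close> ensures \<open>Suc n = (j - i) Q > n0\<close>, so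
    that \<open>far\<close> is available for every pair \<open>i < j\<close>.\<close>
  define Q where "Q = Suc n0"
  define s where "s i j = k ^ (i * Q) * k * (k ^ ((j - i) * Q) - 1)" for i j :: nat
  \<comment> \<open>\<open>bad i j J\<close> excludes that all coordinates of the approximating
    vector are multiples of \<open>k^J\<close>. By irrationality it holds for large
    \<open>J\<close>.\<close>
  define bad where "bad i j J \<longleftrightarrow> (\<forall>a b c :: int. \<kappa> ^ J * \<bar>of_int (s i j) * \<alpha> - of_int a\<bar> \<le> 1 \<longrightarrow>
      \<kappa> ^ J * \<bar>of_int (s i j) * \<beta> - of_int b\<bar> \<le> 1 \<longrightarrow>
      \<kappa> ^ J * \<bar>of_int (s i j) * \<gamma> - of_int c\<bar> \<le> 1 \<longrightarrow> False)" for i j J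
  have "\<exists>J0. \<forall>J\<ge>J0. bad i j J" if "i < j" for i j
  proof -
    have "k ^ ((j - i) * Q) > 1" using that k_ge unfolding Q_def by (intro one_less_power) auto
    hence "s i j \<noteq> 0" unfolding s_def using k_ge by simp
    with irr consider "of_int (s i j) * \<alpha> \<notin> \<int>" | "of_int (s i j) * \<beta> \<notin> \<int>" | "of_int (s i j) * \<gamma> \<notin> \<int>"
      by blast
    thus ?thesis
    proof cases
      case 1
      show ?thesis by (rule not_Ints_separated[OF 1 \<kappa>]) (unfold bad_def, meson not_le)
    next
      case 2
      show ?thesis by (rule not_Ints_separated[OF 2 \<kappa>]) (unfold bad_def, meson not_le)
    next
      case 3
      show ?thesis by (rule not_Ints_separated[OF 3 \<kappa>]) (unfold bad_def, meson not_le)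
    qed
  qed
  then obtain J0 where J0: "\<And>i j J. i < j \<Longrightarrow> J0 i j \<le> J \<Longrightarrow> bad i j J" by metis
  \<comment> \<open>Only finitely many pairs can occur, so \<open>J\<close> is fixed before the
    pigeonhole principle selects one.\<close>
  define J where "J = Max ((\<lambda>(i, j). J0 i j) ` ({..M ^ 3} \<times> {..M ^ 3}))"
  have bad: "bad i j J" if "i < j" "j \<le> M ^ 3" for i j
  proof -
    have "J0 i j \<in> (\<lambda>(i, j). J0 i j) ` ({..M ^ 3} \<times> {..M ^ 3})" using that by force
    hence "J0 i j \<le> J" unfolding J_def by (intro Max_ge) auto
    thus ?thesis using J0 that(1) by blast
  qed
  \<comment> \<open>The additional \<open>1\<close> in the exponent leaves a factor
    \<open>k^2\<close> in the coordinate sum after the removal of at most \<open>k^(N-1)\<close>, so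
    exceptional residues cause no obstruction.\<close>
  obtain i j :: nat and u v w where ij: "i < j" "j \<le> M ^ 3" and
    a: "\<bar>\<kappa> ^ (J + 1 + j * Q) * \<alpha> - \<kappa> ^ (J + 1 + i * Q) * \<alpha> - of_int u\<bar> < 1 / M"
       "\<bar>\<kappa> ^ (J + 1 + j * Q) * \<beta> - \<kappa> ^ (J + 1 + i * Q) * \<beta> - of_int v\<bar> < 1 / M"
       "\<bar>\<kappa> ^ (J + 1 + j * Q) * \<gamma> - \<kappa> ^ (J + 1 + i * Q) * \<gamma> - of_int w\<bar> < 1 / M"
    using simultaneous_pigeonhole[of M "\<lambda>i. \<kappa> ^ (J + 1 + i * Q) * \<alpha>"
        "\<lambda>i. \<kappa> ^ (J + 1 + i * Q) * \<beta>" "\<lambda>i. \<kappa> ^ (J + 1 + i * Q) * \<gamma>"] M(2)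
    by (metis gr0I of_nat_0 not_numeral_le_zero)
  define n where "n = (j - i) * Q - 1"
  have n: "Suc n = (j - i) * Q" "n0 \<le> n" using ij(1) unfolding n_def Q_def by (cases "j - i"; simp)+
  define N where "N = J + i * Q"
  define t where "t = k ^ Suc N * (k ^ Suc n - 1)"
  have ts: "t = k ^ J * s i j" unfolding t_def s_def N_def n(1) by (simp add: power_add ac_simps)
  have "J + 1 + j * Q = Suc N + Suc n"
    unfolding N_def n(1) using ij(1) by (simp add: add_mult_distrib[symmetric])
  hence tk: "real_of_int t = \<kappa> ^ (J + 1 + j * Q) - \<kappa> ^ (J + 1 + i * Q)"
    unfolding t_def \<kappa>_def N_def by (simp add: power_add algebra_simps)
  have b: "\<bar>of_int u - of_int t * \<alpha>\<bar> < 1 / M" "\<bar>of_int v - of_int t * \<beta>\<bar> < 1 / M"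
    "\<bar>of_int w - of_int t * \<gamma>\<bar> < 1 / M"
    using a unfolding tk by (simp_all add: left_diff_distrib abs_minus_commute)
  have "real_of_int t * \<alpha> + real_of_int t * \<beta> + real_of_int t * \<gamma> = of_int t"
    using sum by (simp flip: distrib_left)
  hence "\<bar>real_of_int (u + v + w - t)\<bar> < 1" using b M'(2) by simp
  hence sumt: "u + v + w = t" by linarith
  show False
  proof (cases "k ^ N dvd u \<and> k ^ N dvd v \<and> k ^ N dvd w")
    case True
    hence "k ^ J dvd u" "k ^ J dvd v" "k ^ J dvd w" unfolding N_def power_add by (auto dest: dvd_mult_left)
    then obtain x y z where e: "u = k ^ J * x" "v = k ^ J * y" "w = k ^ J * z" by (elim dvdE)
    have *: "\<kappa> ^ J * \<bar>of_int (s i j) * \<xi> - of_int e\<bar> \<le> 1"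
      if "\<bar>of_int (k ^ J * e) - of_int t * \<xi>\<bar> < 1 / M" for \<xi> e
    proof -
      have "of_int (k ^ J * e) - of_int t * \<xi> = - (\<kappa> ^ J * (of_int (s i j) * \<xi> - of_int e))"
        unfolding ts \<kappa>_def by (simp add: algebra_simps)
      hence "\<bar>of_int (k ^ J * e) - of_int t * \<xi>\<bar> = \<kappa> ^ J * \<bar>of_int (s i j) * \<xi> - of_int e\<bar>"
        using \<kappa> by (simp add: abs_mult)
      thus ?thesis using that M'(3) by (metis less_imp_le order_trans)
    qed
    from bad[OF ij] *[OF b(1)[unfolded e]] *[OF b(2)[unfolded e]] *[OF b(3)[unfolded e]]
    show False unfolding bad_def by blast
  next
    case False
    then obtain B x y z where B: "B < N" and e: "u = k ^ B * x" "v = k ^ B * y" "w = k ^ B * z"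
      and nd: "\<not> (k dvd x \<and> k dvd y \<and> k dvd z)" by (rule primitive_part)
    obtain A where A: "N = Suc A + B" using B by (metis add.commute less_imp_Suc_add add_Suc_right add_Suc)
    define r where "r = k ^ Suc (Suc A) * (k ^ Suc n - 1)"
    have tr: "t = k ^ B * r" unfolding t_def r_def A by (simp add: power_add ac_simps)
    have "k ^ B * (x + y + z) = k ^ B * r" using sumt e tr by (simp add: distrib_left)
    hence xyz: "x + y + z = r" using k_ge by simp
    \<comment> \<open>Division by \<open>k^B\<close> only improves the approximation.\<close>
    have *: "\<bar>of_int e - of_int r * \<xi>\<bar> < 1 / M" if "\<bar>of_int (k ^ B * e) - of_int t * \<xi>\<bar> < 1 / M" for \<xi> e
    proof -
      have "of_int (k ^ B * e) - of_int t * \<xi> = \<kappa> ^ B * (of_int e - of_int r * \<xi>)"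
        unfolding tr \<kappa>_def by (simp add: algebra_simps)
      hence "\<bar>of_int (k ^ B * e) - of_int t * \<xi>\<bar> = \<kappa> ^ B * \<bar>of_int e - of_int r * \<xi>\<bar>"
        using \<kappa> by (simp add: abs_mult)
      moreover have "1 * \<bar>of_int e - of_int r * \<xi>\<bar> \<le> \<kappa> ^ B * \<bar>of_int e - of_int r * \<xi>\<bar>"
        using \<kappa> by (intro mult_right_mono one_le_power) auto
      ultimately show ?thesis using that by (metis le_less_trans mult_1)
    qed
    note c = *[OF b(1)[unfolded e]] *[OF b(2)[unfolded e]] *[OF b(3)[unfolded e]]
    have c': "\<bar>of_int x - of_int r * \<alpha>\<bar> \<le> 1" "\<bar>of_int y - of_int r * \<beta>\<bar> \<le> 1" "\<bar>of_int z - of_int r * \<gamma>\<bar> \<le> 1"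
      using c M'(3) by linarith+
    have "far (Suc (Suc A)) n x y z" using n0[OF n(2) c'[unfolded r_def]] .
    hence "expansion_diff x y z"
      using xyz nd unfolding r_def by (intro expansion_diff_power_diff[of x y z "Suc A" n]) auto
    moreover have "(x, y, z) \<noteq> (0, 0, 0)" using nd by auto
    ultimately have "\<delta> \<le> \<bar>of_int x - of_int r * \<alpha>\<bar> + \<bar>of_int y - of_int r * \<beta>\<bar> + \<bar>of_int z - of_int r * \<gamma>\<bar>"
      using sep unfolding separated_def by blast
    thus False using c M'(1) by linarith
  qed
qed

section \<open>Projections of the attractor\<close>

definition fractal :: "(real ^ 3) set" where
  "fractal = attractor k (digit_set k l)"

abbreviation vec_of :: "int \<times> int \<times> int \<Rightarrow> real ^ 3" where
  "vec_of \<equiv> \<lambda>(x, y, z). int_vec3 x y z"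

lemma digit_set_eq: "digit_set k l = vec_of ` digits"
proof (intro equalityI subsetI)
  fix u assume "u \<in> digit_set k l"
  then obtain x y z where "u = int_vec3 x y z" "(x, y, z) \<in> digits"
    unfolding digit_set_def digits_def by (auto simp: cong_iff_dvd_diff)
  thus "u \<in> vec_of ` digits" by (intro image_eqI[of _ _ "(x, y, z)"]) auto
next
  fix u assume "u \<in> vec_of ` digits"
  thus "u \<in> digit_set k l" unfolding digit_set_def digits_def by (auto simp: cong_iff_dvd_diff)
qed

lemma fractal_nonempty: "fractal \<noteq> {}"
  and compact_fractal: "compact fractal"
  and fractal_eq: "fractal = hutchinson k (vec_of ` digits) fractal"
  using attractor_fixpoint[OF k_ge, of "vec_of ` digits"] finite_digits digits_nonempty
  unfolding fractal_def digit_set_eq by auto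

text \<open>Half of the identity \<open>k^n T = T + D_n\<close> for the attractor \<open>T\<close>;
  the other half is \<open>expansion_fractal\<close>.\<close>

lemma fractal_expansion:
  assumes "x \<in> fractal"
  shows "\<exists>w\<in>expansions n. of_int k ^ n *\<^sub>R x - vec_of w \<in> fractal"
proof (induction n)
  case 0
  have "int_vec3 0 0 0 = 0" by (simp add: vec3_eq_iff)
  thus ?case using assms by simp
next
  case (Suc n)
  then obtain a b c where w: "(a, b, c) \<in> expansions n" "of_int k ^ n *\<^sub>R x - int_vec3 a b c \<in> fractal" by auto
  define y where "y = of_int k ^ n *\<^sub>R x - int_vec3 a b c"
  have "y \<in> hutchinson k (vec_of ` digits) fractal" using w(2) fractal_eq unfolding y_def by simp
  then obtain p q r where d: "(p, q, r) \<in> digits" "of_int k *\<^sub>R y - int_vec3 p q r \<in> fractal"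
    unfolding hutchinson_iff[OF k_ge] by auto
  have "(p + k * a, q + k * b, r + k * c) \<in> expansions (Suc n)" using d(1) w(1) by force
  moreover have "of_int k *\<^sub>R y - int_vec3 p q r =
      of_int k ^ Suc n *\<^sub>R x - int_vec3 (p + k * a) (q + k * b) (r + k * c)"
    unfolding y_def by (simp add: vec3_eq_iff algebra_simps)
  ultimately show ?case using d(2) by (metis case_prod_conv)
qed

lemma expansion_fractal:
  assumes "w \<in> expansions n" "y \<in> fractal"
  shows "\<exists>x\<in>fractal. of_int k ^ n *\<^sub>R x = vec_of w + y"
  using assms
proof (induction n arbitrary: w y)
  case 0
  have "int_vec3 0 0 0 = 0" by (simp add: vec3_eq_iff)
  thus ?case using 0 by auto
next
  case (Suc n)
  then obtain p q r a b c where w: "(p, q, r) \<in> digits" "(a, b, c) \<in> expansions n"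
    "w = (p + k * a, q + k * b, r + k * c)" by auto
  define y' where "y' = (y + int_vec3 p q r) /\<^sub>R of_int k"
  have "vec_of (p, q, r) \<in> vec_of ` digits" using w(1) by (rule imageI)
  moreover have "y' = (y + vec_of (p, q, r)) /\<^sub>R of_int k" unfolding y'_def by simp
  ultimately have "y' \<in> hutchinson k (vec_of ` digits) fractal"
    using Suc.prems(2) unfolding hutchinson_def by blast
  hence "y' \<in> fractal" using fractal_eq by simp
  then obtain x where x: "x \<in> fractal" "of_int k ^ n *\<^sub>R x = int_vec3 a b c + y'"
    using Suc.IH[OF w(2)] by auto
  have "of_int k ^ Suc n *\<^sub>R x = of_int k *\<^sub>R (int_vec3 a b c + y')"
    unfolding x(2)[symmetric] by simp
  also have "\<dots> = vec_of w + y" unfolding y'_def w(3) using k_ge by (simp add: vec3_eq_iff algebra_simps)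
  finally show ?case using x(1) by blast
qed

lemma card_expansions_real: "real (card (expansions n)) = (of_int k ^ n) ^ 2"
proof -
  have "real (nat k) = of_int k" using k_ge by simp
  thus ?thesis unfolding card_expansions by (simp add: power_mult[symmetric] mult.commute)
qed

lemma compact_projection: "linear \<phi> \<Longrightarrow> compact ((\<phi> :: real ^ 3 \<Rightarrow> real ^ 2) ` fractal)"
  by (intro compact_continuous_image compact_fractal linear_continuous_on)
    (simp add: linear_conv_bounded_linear)

text \<open>The translates of \<open>S\<close> by the points of \<open>\<phi> D_n\<close> cover
  \<open>k^n S\<close>, and their number equals the area factor. Indexing by expansions rather than
  by their projections makes the separation exclude coincidences too.\<close>

lemma positive_measure_imp_separated:
  fixes \<phi> :: "real ^ 3 \<Rightarrow> real ^ 2"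
  assumes lin: "linear \<phi>" and pos: "0 < measure lebesgue (\<phi> ` fractal)"
  obtains \<epsilon> where "0 < \<epsilon>"
    "\<And>x y z. expansion_diff x y z \<Longrightarrow> (x, y, z) \<noteq> (0, 0, 0) \<Longrightarrow> \<epsilon> \<le> norm (\<phi> (int_vec3 x y z))"
proof -
  obtain \<epsilon> where \<epsilon>: "0 < \<epsilon>"
    "\<And>I (p :: int \<times> int \<times> int \<Rightarrow> real ^ 2) c i j. finite I \<Longrightarrow> 0 < c \<Longrightarrow>
      real (card I) = c ^ DIM(real ^ 2) \<Longrightarrow>
      (\<lambda>x. c *\<^sub>R x) ` (\<phi> ` fractal) \<subseteq> (\<Union>i\<in>I. (\<lambda>x. p i + x) ` (\<phi> ` fractal)) \<Longrightarrow> i \<in> I \<Longrightarrow> j \<in> I \<Longrightarrow>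
      i \<noteq> j \<Longrightarrow> \<epsilon> \<le> norm (p i - p j)"
    using cover_translates_separated[OF compact_projection[OF lin] pos] by metis
  have "\<epsilon> \<le> norm (\<phi> (int_vec3 x y z))" if E: "expansion_diff x y z" and nz: "(x, y, z) \<noteq> (0, 0, 0)" for x y z
  proof -
    obtain n p q r p' q' r' where w: "(p, q, r) \<in> expansions n" "(p', q', r') \<in> expansions n"
      and d: "x = p - p'" "y = q - q'" "z = r - r'"
      using E unfolding expansion_diff_def by blast
    have cov: "(\<lambda>x. (of_int k ^ n) *\<^sub>R x) ` (\<phi> ` fractal) \<subseteq>
        (\<Union>w\<in>expansions n. (\<lambda>x. (\<phi> (vec_of w)) + x) ` (\<phi> ` fractal))"
    proof safe
      fix x assume "x \<in> fractal"
      then obtain w where w: "w \<in> expansions n" "of_int k ^ n *\<^sub>R x - vec_of w \<in> fractal"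
        using fractal_expansion by blast
      have "of_int k ^ n *\<^sub>R \<phi> x = \<phi> (vec_of w) + \<phi> (of_int k ^ n *\<^sub>R x - vec_of w)"
        by (simp add: linear_diff[OF lin] linear_cmul[OF lin])
      thus "of_int k ^ n *\<^sub>R \<phi> x \<in> (\<Union>w\<in>expansions n. (\<lambda>x. (\<phi> (vec_of w)) + x) ` (\<phi> ` fractal))"
        using w by blast
    qed
    have "(p, q, r) \<noteq> (p', q', r')" using nz d by auto
    moreover have "0 < (of_int k :: real) ^ n" using k_ge by simp
    ultimately have "\<epsilon> \<le> norm (\<phi> (vec_of (p, q, r)) - \<phi> (vec_of (p', q', r')))"
      using \<epsilon>(2)[of "expansions n" "of_int k ^ n" "\<lambda>w. \<phi> (vec_of w)", OF finite_expansions _ _ cov w]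
        card_expansions_real by simp
    thus ?thesis by (simp add: linear_diff[OF lin, symmetric] int_vec3_diff d)
  qed
  with \<epsilon>(1) that show thesis by blast
qed

text \<open>A fixed point \<open>y\<close> of the attractor places every \<open>\<phi> w\<close>
  with \<open>w\<close> in \<open>D_n\<close> within distance \<open>|\<phi> y|\<close> of
  \<open>k^n S\<close>, uniformly in \<open>n\<close>.\<close>

lemma separated_imp_positive_measure:
  fixes \<phi> :: "real ^ 3 \<Rightarrow> real ^ 2"
  assumes lin: "linear \<phi>" and \<delta>: "0 < \<delta>"
    and sep: "\<And>n w w'. w \<in> expansions n \<Longrightarrow> w' \<in> expansions n \<Longrightarrow> w \<noteq> w' \<Longrightarrow>
      \<delta> \<le> norm (\<phi> (vec_of w) - \<phi> (vec_of w'))"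
  shows "0 < measure lebesgue (\<phi> ` fractal)"
proof -
  obtain y where y: "y \<in> fractal" using fractal_nonempty by blast
  show ?thesis
  proof (rule positive_measure_of_separated_points[OF compact_projection[OF lin] \<delta>])
    fix C :: real
    have "1 < real_of_int k" using k_ge by simp
    then obtain n where n: "C < real_of_int k ^ n" using real_arch_pow by blast
    have near: "\<exists>x\<in>\<phi> ` fractal. norm (of_int k ^ n *\<^sub>R x - \<phi> (vec_of w)) \<le> norm (\<phi> y)"
      if "w \<in> expansions n" for w
    proof -
      obtain x where x: "x \<in> fractal" "of_int k ^ n *\<^sub>R x = vec_of w + y"
        using expansion_fractal[OF \<open>w \<in> expansions n\<close> y] by blast
      have "of_int k ^ n *\<^sub>R \<phi> x = \<phi> (vec_of w) + \<phi> y"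
        unfolding linear_cmul[OF lin, symmetric] x(2) by (rule linear_add[OF lin])
      thus ?thesis using x(1) by (intro bexI[of _ "\<phi> x"]) auto
    qed
    show "\<exists>I (p :: int \<times> int \<times> int \<Rightarrow> real ^ 2) c. C < c \<and> 0 < c \<and> finite I \<and> real (card I) = c ^ DIM(real ^ 2) \<and>
      (\<forall>i\<in>I. \<forall>j\<in>I. i \<noteq> j \<longrightarrow> \<delta> \<le> norm (p i - p j)) \<and>
      (\<forall>i\<in>I. \<exists>x\<in>\<phi> ` fractal. norm (c *\<^sub>R x - p i) \<le> norm (\<phi> y))"
    proof (intro exI[of _ "expansions n"] exI[of _ "\<lambda>w. \<phi> (vec_of w)"] exI[of _ "of_int k ^ n"]
        conjI ballI impI)
      show "C < of_int k ^ n" "0 < (of_int k :: real) ^ n" using n k_ge by simp_all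
      show "finite (expansions n)" by (rule finite_expansions)
      show "real (card (expansions n)) = (of_int k ^ n) ^ DIM(real ^ 2)" using card_expansions_real by simp
    qed (use sep near in blast)+
  qed
qed

lemma positive_measure_if:
  assumes cop: "coprime_vector a b c" and v: "v = t *\<^sub>R int_vec3 a b c" and proj: "projection_along v \<phi>"
    and ok: "coprime (a + b + c) k \<or> k = 3 \<and> l = 1 \<and> exceptional a b c"
  shows "0 < measure lebesgue (\<phi> ` fractal)"
proof -
  note lin = projection_alongD(1)[OF proj]
  obtain \<delta> where \<delta>: "0 < \<delta>"
    "\<And>x y z. norm (\<phi> (int_vec3 x y z)) < \<delta> \<Longrightarrow> \<exists>m. x = m * a \<and> y = m * b \<and> z = m * c"
    using integer_points_separated[OF cop v proj] by blast
  show ?thesis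
  proof (rule separated_imp_positive_measure[OF lin \<delta>(1)], rule ccontr)
    fix n w w' assume w: "w \<in> expansions n" "w' \<in> expansions n" "w \<noteq> w'"
      and close: "\<not> \<delta> \<le> norm (\<phi> (vec_of w) - \<phi> (vec_of w'))"
    obtain p q r where pqr: "w = (p, q, r)" by (rule prod_cases3)
    obtain p' q' r' where pqr': "w' = (p', q', r')" by (rule prod_cases3)
    have "norm (\<phi> (int_vec3 (p - p') (q - q') (r - r'))) < \<delta>"
      using close pqr pqr' by (simp add: linear_diff[OF lin, symmetric] int_vec3_diff)
    then obtain m where "p - p' = m * a" "q - q' = m * b" "r - r' = m * c" using \<delta>(2) by blast
    with expansions_no_collision[OF cop ok] w show False unfolding pqr pqr' by blast
  qed
qed

lemma positive_measure_only_if: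
  assumes v0: "v \<noteq> 0" and proj: "projection_along v \<phi>" and pos: "0 < measure lebesgue (\<phi> ` fractal)"
  obtains a b c t where "coprime_vector a b c" "t \<noteq> 0" "v = t *\<^sub>R int_vec3 a b c"
    "coprime (a + b + c) k \<or> k = 3 \<and> l = 1 \<and> exceptional a b c"
proof -
  note p = projection_alongD[OF proj]
  obtain \<epsilon> where \<epsilon>: "0 < \<epsilon>"
    "\<And>x y z. expansion_diff x y z \<Longrightarrow> (x, y, z) \<noteq> (0, 0, 0) \<Longrightarrow> \<epsilon> \<le> norm (\<phi> (int_vec3 x y z))"
    using positive_measure_imp_separated[OF p(1) pos] by blast
  obtain K where K: "0 < K" "\<And>x. norm (\<phi> x) \<le> K * (\<bar>x $ 1\<bar> + \<bar>x $ 2\<bar> + \<bar>x $ 3\<bar>)"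
    using projection_norm_le[OF p(1)] by blast
  \<comment> \<open>\<open>\<phi>\<close> vanishes on the line and is bounded by \<open>K\<close>
    times the l1 norm, so separation in the plane bounds the distance to the line from below. The
    factor \<open>u\<close> permits rescaling \<open>v\<close> to coordinate sum 1.\<close>
  have sep: "separated (\<epsilon> / K) (u * v $ 1) (u * v $ 2) (u * v $ 3)" for u
    unfolding separated_def
  proof (intro allI impI)
    fix x y z r assume h: "expansion_diff x y z" "(x, y, z) \<noteq> (0, 0, 0)"
    have "\<phi> (int_vec3 x y z - (r * u) *\<^sub>R v) = \<phi> (int_vec3 x y z)"
      using p(4) by (simp add: linear_diff[OF p(1)])
    hence "\<epsilon> \<le> norm (\<phi> (int_vec3 x y z - (r * u) *\<^sub>R v))" using \<epsilon>(2)[OF h] by simp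
    also have "\<dots> \<le> K * (\<bar>of_int x - r * (u * v $ 1)\<bar> + \<bar>of_int y - r * (u * v $ 2)\<bar> + \<bar>of_int z - r * (u * v $ 3)\<bar>)"
      using K(2)[of "int_vec3 x y z - (r * u) *\<^sub>R v"] by (simp add: mult.assoc)
    finally show "\<epsilon> / K \<le> \<bar>of_int x - r * (u * v $ 1)\<bar> + \<bar>of_int y - r * (u * v $ 2)\<bar> + \<bar>of_int z - r * (u * v $ 3)\<bar>"
      using K(1) by (simp add: field_simps)
  qed
  have eK: "0 < \<epsilon> / K" using \<epsilon>(1) K(1) by simp
  define \<sigma> where "\<sigma> = v $ 1 + v $ 2 + v $ 3"
  have vnz: "v $ 1 \<noteq> 0 \<or> v $ 2 \<noteq> 0 \<or> v $ 3 \<noteq> 0" using v0 by (simp add: vec3_eq_iff)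
  have \<sigma>: "\<sigma> \<noteq> 0"
    using not_separated_sum_zero[OF eK _ vnz] sep[of 1] unfolding \<sigma>_def by auto
  have "1 / \<sigma> * v $ 1 + 1 / \<sigma> * v $ 2 + 1 / \<sigma> * v $ 3 = 1"
    using \<sigma> unfolding \<sigma>_def by (simp add: add_divide_distrib[symmetric])
  from separated_imp_rational[OF eK this sep] obtain s :: int where s: "s \<noteq> 0"
    "of_int s * (1 / \<sigma> * v $ 1) \<in> \<int>" "of_int s * (1 / \<sigma> * v $ 2) \<in> \<int>" "of_int s * (1 / \<sigma> * v $ 3) \<in> \<int>"
    by blast
  then obtain A B C where ABC: "of_int s * (1 / \<sigma> * v $ 1) = of_int A"
    "of_int s * (1 / \<sigma> * v $ 2) = of_int B" "of_int s * (1 / \<sigma> * v $ 3) = of_int C" by (elim Ints_cases)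
  have vs: "v = (\<sigma> / of_int s) *\<^sub>R int_vec3 A B C"
    unfolding vec3_eq_iff using ABC[symmetric] \<sigma> s(1) by simp
  have "(A, B, C) \<noteq> (0, 0, 0)" using ABC vnz \<sigma> s(1) by auto
  then obtain g a b c where g: "A = g * a" "B = g * b" "C = g * c" "g \<noteq> 0" and cop: "coprime_vector a b c"
    by (rule integer_vector_primitive)
  define t where "t = \<sigma> / of_int s * of_int g"
  have t: "t \<noteq> 0" unfolding t_def using \<sigma> s(1) g(4) by simp
  have vt: "v = t *\<^sub>R int_vec3 a b c" unfolding t_def vs g vec3_eq_iff by simp
  have "coprime (a + b + c) k \<or> k = 3 \<and> l = 1 \<and> exceptional a b c"
  proof (rule ccontr)
    assume "\<not> ?thesis"
    then obtain m where m: "m \<noteq> 0" "expansion_diff (m * a) (m * b) (m * c)"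
      using rational_collision[OF cop] by blast
    have "(a, b, c) \<noteq> (0, 0, 0)" using cop unfolding coprime_vector_def by auto
    hence "(m * a, m * b, m * c) \<noteq> (0, 0, 0)" using m(1) by auto
    hence "\<epsilon> \<le> norm (\<phi> (int_vec3 (m * a) (m * b) (m * c)))" using \<epsilon>(2) m(2) by blast
    moreover have "int_vec3 (m * a) (m * b) (m * c) = (of_int m / t) *\<^sub>R v"
      unfolding vt vec3_eq_iff using t by simp
    ultimately show False using p(4) \<epsilon>(1) by simp
  qed
  with that cop t vt show thesis by blast
qed

end

theorem theorem3:
  fixes k l :: int and v :: "real ^ 3" and \<phi> :: "real ^ 3 \<Rightarrow> real ^ 2"
  assumes "2 \<le> k" and "0 \<le> l" and "real_of_int l < real_of_int k / 2"
    and "v \<noteq> 0"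
    and "projection_along v \<phi>"
  shows "0 < emeasure lebesgue (\<phi> ` attractor k (digit_set k l)) \<longleftrightarrow>
    (\<exists>a b c :: int. coprime_vector a b c \<and>
       (\<exists>t :: real. t \<noteq> 0 \<and> v = t *\<^sub>R int_vec3 a b c) \<and>
       ((k, l) \<noteq> (3, 1) \<longrightarrow> coprime (a + b + c) k) \<and>
       ((k, l) = (3, 1) \<longrightarrow>
          coprime (a + b + c) 3 \<or>
          (3 dvd a + b + c \<and>
           [a = b] (mod 3) \<and>
           [b = - ((a + b + c) div 3)] (mod 3) \<and>
           \<not> [- ((a + b + c) div 3) = 0] (mod 3))))"
proof -
  interpret digit_system k l using assms(1-3) by unfold_locales linarith+
  have "\<phi> ` fractal \<in> lmeasurable"
    using lmeasurable_compact compact_projection projection_alongD(1)[OF assms(5)] by blast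
  hence "emeasure lebesgue (\<phi> ` fractal) = ennreal (measure lebesgue (\<phi> ` fractal))"
    by (rule emeasure_eq_measure2)
  hence m: "0 < emeasure lebesgue (\<phi> ` fractal) \<longleftrightarrow> 0 < measure lebesgue (\<phi> ` fractal)"
    by (simp only: ennreal_less_zero_iff[symmetric])
  have "0 < measure lebesgue (\<phi> ` fractal) \<longleftrightarrow> (\<exists>a b c t. coprime_vector a b c \<and> t \<noteq> 0 \<and>
      v = t *\<^sub>R int_vec3 a b c \<and> (coprime (a + b + c) k \<or> k = 3 \<and> l = 1 \<and> exceptional a b c))"
    using positive_measure_if[OF _ _ assms(5)] positive_measure_only_if[OF assms(4,5)] by metis
  moreover have "((k, l) \<noteq> (3, 1) \<longrightarrow> coprime (a + b + c) k) \<and> ((k, l) = (3, 1) \<longrightarrow>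
      coprime (a + b + c) 3 \<or> (3 dvd a + b + c \<and> [a = b] (mod 3) \<and>
        [b = - ((a + b + c) div 3)] (mod 3) \<and> \<not> [- ((a + b + c) div 3) = 0] (mod 3))) \<longleftrightarrow>
      coprime (a + b + c) k \<or> k = 3 \<and> l = 1 \<and> exceptional a b c" for a b c
    unfolding exceptional_def by (cases "(k, l) = (3, 1)") auto
  ultimately show ?thesis unfolding fractal_def[symmetric] m by blast
qed

end
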